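(* Let $\mathcal S$ be a family of bridgeless connected graphs and $\beta\in(1,2]$. Assume there exists $\mathcal S'\subseteq\mathcal S$ such that: (i) $Q(G,\lambda)>0$ for all $G\in\mathcal S'$ and all $\lambda\in(1,\beta)$; (ii) for every separable $G\in\mathcal S$, all blocks of $G$ belong to $\mathcal S$; (iii) for every non-separable $G\in\mathcal S\setminus\mathcal S'$, at least one of the following holds: (a) there is an edge $e=u_1u_2$ of $G$ such that $G-e$ has a cut-vertex $v$, and edge-disjoint subgraphs $H_1,H_2$ with $E(H_1)\cup E(H_2)=E(G-e)$, $V(H_1)\cap V(H_2)=\{v\}$, $V(H_1)\cup V(H_2)=V(G)$, $u_1\in V(H_1)$, $u_2\in V(H_2)$, such that $G_1=H_1+vu_1$ and $G_2=H_2+vu_2$ both belong to $\mathcal S$; (b) there is an edge $e$ of $G$ such that $G-e,G/e\in\mathcal S$ and both $b(G-e)$ and $b(G/e)$ are odd; (c) there are subgraphs $G_1,G_2$ of $G$ with $V(G_1)\cap V(G_2)=\{u_1,u_2\}$, $V(G_1)\cup V(G_2)=V(G)$, $E(G_1)\cap E(G_2)=\emptyset$, $E(G_1)\cup E(G_2)=E(G)$, such that $b(G_1)+b(G_2)$ is even and, for $i=1,2$, $|E(G_i)|\ge 2$ and both $G_i$ and $G_i+u_1u_2$ belong to $\mathcal S$; (d) there are subgraphs $G_1,G_2$ of $G$ with $|E(G_1)|\ge 3$, $|E(G_2)|\ge 2$, $V(G_1)\cap V(G_2)=\{u_1,u_2\}$, $V(G_1)\cup V(G_2)=V(G)$, $E(G_1)\cap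 E(G_2)=\emptyset$, $E(G_1)\cup E(G_2)=E(G)$, such that $b(G_1/u_1u_2)+b(G_2)$ is odd and $G_1+u_1u_2$, $G_1/u_1u_2$, $G_2$, $G_2+u_1u_2$, $G_2+2u_1u_2$ all belong to $\mathcal S$. Then $Q(G,\lambda)>0$ for all $G\in\mathcal S$ and all real $\lambda\in(1,\beta)$.
   Context: Graphs are finite, undirected, possibly with loops and parallel edges. The flow polynomial $F(G,\lambda)$ is determined by: $F(G,\lambda)=1$ if $E(G)=\emptyset$; $F(G,\lambda)=0$ if $G$ has a bridge; multiplicative over disjoint unions; $F(G,\lambda)=(\lambda-1)F(G-e,\lambda)$ if $e$ is a loop; otherwise $F(G,\lambda)=F(G/e,\lambda)-F(G-e,\lambda)$ ($G/e$ = contraction of $e$). A graph is non-separable if it is connected, has no cut-vertex, and either has no loops or has exactly one vertex and one edge; otherwise it is separable. A block is a maximal non-separable subgraph; $b(G)$ is the number of blocks of $G$ having at least one edge. For vertices $u_1,u_2$: $G/u_1u_2$ is obtained by identifying $u_1$ and $u_2$ (edges between them become loops); $G+u_1u_2$ by adding a new edge joining them; $G+2u_1u_2$ by adding two new parallel edges joining them. For a connected graph $G$, $p(G)=|E(G)|-|V(G)|+b(G)-1$ and $Q(G,\lambda)=(-1)^{p(G)}F(G,\lambda)$. *)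

theory Defs
  imports Main "HOL-Library.Uprod" "HOL-Computational_Algebra.Polynomial"
begin

text \<open>Vertices of arbitrary type; edges are labelled by natural numbers (so that fresh
  edges can always be added); each edge has an unordered pair of ends (a loop has
  ends Upair v v).\<close>

record 'v graph =
  verts :: "'v set"
  edges :: "nat set"
  ends  :: "nat \<Rightarrow> 'v uprod"

definition wf_graph :: "'v graph \<Rightarrow> bool" where
  "wf_graph G \<longleftrightarrow> finite (verts G) \<and> finite (edges G) \<and>
     (\<forall>e\<in>edges G. set_uprod (ends G e) \<subseteq> verts G)"

definition is_loop :: "'v graph \<Rightarrow> nat \<Rightarrow> bool" where
  "is_loop G e \<longleftrightarrow> (\<exists>v. ends G e = Upair v v)"

definition adj :: "'v graph \<Rightarrow> 'v \<Rightarrow> 'v \<Rightarrow> bool" where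
  "adj G x y \<longleftrightarrow> (\<exists>e\<in>edges G. ends G e = Upair x y)"

definition reach :: "'v graph \<Rightarrow> 'v \<Rightarrow> 'v \<Rightarrow> bool" where
  "reach G = (adj G)\<^sup>*\<^sup>*"

definition connected_graph :: "'v graph \<Rightarrow> bool" where
  "connected_graph G \<longleftrightarrow> verts G \<noteq> {} \<and> (\<forall>x\<in>verts G. \<forall>y\<in>verts G. reach G x y)"

definition ncomp :: "'v graph \<Rightarrow> nat" where
  "ncomp G = card (verts G // {(x, y). x \<in> verts G \<and> y \<in> verts G \<and> reach G x y})"

definition delete_edge :: "'v graph \<Rightarrow> nat \<Rightarrow> 'v graph" where
  "delete_edge G e = G\<lparr>edges := edges G - {e}\<rparr>"

definition delete_vertex :: "'v graph \<Rightarrow> 'v \<Rightarrow> 'v graph" where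
  "delete_vertex G v = G\<lparr>verts := verts G - {v},
      edges := {e\<in>edges G. v \<notin> set_uprod (ends G e)}\<rparr>"

definition identify :: "'v graph \<Rightarrow> 'v \<Rightarrow> 'v \<Rightarrow> 'v graph" where
  "identify G u1 u2 =
     (let f = (\<lambda>x. if x = u2 then u1 else x) in
      G\<lparr>verts := f ` verts G, ends := (\<lambda>e. map_uprod f (ends G e))\<rparr>)"

definition contract :: "'v graph \<Rightarrow> nat \<Rightarrow> 'v graph" where
  "contract G e =
     (let p = (SOME p. ends G e = Upair (fst p) (snd p))
      in identify (delete_edge G e) (fst p) (snd p))"

definition add_edge :: "'v graph \<Rightarrow> 'v \<Rightarrow> 'v \<Rightarrow> 'v graph" where
  "add_edge G u1 u2 =
     (let n = (LEAST n. n \<notin> edges G) in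
      G\<lparr>edges := insert n (edges G), ends := (ends G)(n := Upair u1 u2)\<rparr>)"

definition is_bridge :: "'v graph \<Rightarrow> nat \<Rightarrow> bool" where
  "is_bridge G e \<longleftrightarrow> e \<in> edges G \<and>
     (\<exists>a b. ends G e = Upair a b \<and> \<not> reach (delete_edge G e) a b)"

definition bridgeless :: "'v graph \<Rightarrow> bool" where
  "bridgeless G \<longleftrightarrow> \<not> (\<exists>e. is_bridge G e)"

definition disjoint_union :: "'v graph \<Rightarrow> 'v graph \<Rightarrow> 'v graph" where
  "disjoint_union G1 G2 =
     \<lparr>verts = verts G1 \<union> verts G2, edges = edges G1 \<union> edges G2,
      ends = (\<lambda>e. if e \<in> edges G1 then ends G1 e else ends G2 e)\<rparr>"

definition flow_rules :: "('v graph \<Rightarrow> real poly) \<Rightarrow> bool" where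
  "flow_rules f \<longleftrightarrow>
     (\<forall>G. \<not> wf_graph G \<longrightarrow> f G = 0) \<and>
     (\<forall>G. wf_graph G \<and> edges G = {} \<longrightarrow> f G = 1) \<and>
     (\<forall>G. wf_graph G \<and> (\<exists>e. is_bridge G e) \<longrightarrow> f G = 0) \<and>
     (\<forall>G1 G2. wf_graph G1 \<and> wf_graph G2 \<and> verts G1 \<inter> verts G2 = {} \<and>
        edges G1 \<inter> edges G2 = {} \<longrightarrow> f (disjoint_union G1 G2) = f G1 * f G2) \<and>
     (\<forall>G e. wf_graph G \<and> e \<in> edges G \<and> is_loop G e \<longrightarrow>
        f G = [:-1, 1:] * f (delete_edge G e)) \<and>
     (\<forall>G e. wf_graph G \<and> e \<in> edges G \<and> \<not> is_loop G e \<and> \<not> (\<exists>e'. is_bridge G e') \<longrightarrow>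
        f G = f (contract G e) - f (delete_edge G e))"

definition flow_poly :: "'v graph \<Rightarrow> real poly" where
  "flow_poly = (THE f. flow_rules f)"

definition subgraph :: "'v graph \<Rightarrow> 'v graph \<Rightarrow> bool" where
  "subgraph H G \<longleftrightarrow> wf_graph H \<and> verts H \<subseteq> verts G \<and> edges H \<subseteq> edges G \<and> ends H = ends G"

definition cut_vertex :: "'v graph \<Rightarrow> 'v \<Rightarrow> bool" where
  "cut_vertex G v \<longleftrightarrow> v \<in> verts G \<and> ncomp (delete_vertex G v) > ncomp G"

definition non_separable :: "'v graph \<Rightarrow> bool" where
  "non_separable G \<longleftrightarrow> connected_graph G \<and> \<not> (\<exists>v. cut_vertex G v) \<and>
     ((\<forall>e\<in>edges G. \<not> is_loop G e) \<or> (card (verts G) = 1 \<and> card (edges G) = 1))"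

definition is_block :: "'v graph \<Rightarrow> 'v graph \<Rightarrow> bool" where
  "is_block G H \<longleftrightarrow> subgraph H G \<and> non_separable H \<and>
     (\<forall>H'. subgraph H' G \<and> non_separable H' \<and> subgraph H H' \<longrightarrow> H' = H)"

definition nblocks :: "'v graph \<Rightarrow> nat" where
  "nblocks G = card {H. is_block G H \<and> edges H \<noteq> {}}"

definition pexp :: "'v graph \<Rightarrow> int" where
  "pexp G = int (card (edges G)) - int (card (verts G)) + int (nblocks G) - 1"

definition Qf :: "'v graph \<Rightarrow> real \<Rightarrow> real" where
  "Qf G x = (-1) powi (pexp G) * poly (flow_poly G) x"

definition graph_iso :: "'v graph \<Rightarrow> 'v graph \<Rightarrow> bool" where
  "graph_iso G H \<longleftrightarrow> (\<exists>f g. bij_betw f (verts G) (verts H) \<and> bij_betw g (edges G) (edges H) \<and>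
     (\<forall>e\<in>edges G. ends H (g e) = map_uprod f (ends G e)))"

definition in_family :: "'v graph \<Rightarrow> 'v graph set \<Rightarrow> bool" (infix "\<in>\<^sub>\<cong>" 50) where
  "G \<in>\<^sub>\<cong> S \<longleftrightarrow> (\<exists>H\<in>S. graph_iso H G)"

end

theory Submission
  imports Defs
begin

text \<open>The flow polynomial is the subset expansion \<open>F(G) = (\<Sum>A\<subseteq>E. (-1)\<^bsup>|E - A|\<^esup> \<lambda>\<^bsup>n(A)\<^esup>)\<close>, where
  \<open>n(A)\<close> is the nullity of the edge set \<open>A\<close>. Let \<open>P\<^sub>u\<^sub>v(G)\<close> be the part of this sum
  over those \<open>A\<close> that connect \<open>u\<close> and \<open>v\<close>. Then \<open>F(G + uv) = (\<lambda> - 1) P\<^sub>u\<^sub>v(G)\<close>,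
  \<open>F(G / uv) = F(G) + (\<lambda> - 1) P\<^sub>u\<^sub>v(G)\<close>, and for a graph obtained by gluing \<open>H\<close> and \<open>K\<close> along
  \<open>u, v\<close> one has \<open>F(G) = F(H) F(K) + (\<lambda> - 1) P\<^sub>u\<^sub>v(H) P\<^sub>u\<^sub>v(K)\<close>. Each of the alternatives (a)--(d) thus
  expresses \<open>F(G)\<close> through flow polynomials of smaller members of the family, and after insertion of the
  signs \<open>(-1)\<^bsup>p\<^esup>\<close> every summand is positive for \<open>\<lambda> > 1\<close>; the parity conditions on the numbers
  of blocks are exactly what makes the signs agree. A separable graph is a one-vertex gluing, under which
  both \<open>F\<close> and the sign are multiplicative. The theorem follows by induction on \<open>|E| + |V|\<close>.\<close>

section \<open>Connectivity and nullity of edge sets\<close>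


text \<open>\<open>flow_poly\<close> is a definite description, so its value is first established by
  showing that the subset expansion obeys \<open>flow_rules\<close> and that the rules determine a
  function. The pieces \<open>G1\<close>, \<open>G2\<close> are attached to the rest of
  \<open>G\<close> at two vertices, and \<open>F\<close> of a piece alone does not determine how it
  contributes; the partial sum P is the one extra number needed, and it is again a flow polynomial
  divided by \<lambda> - 1. To avoid this division, the identities for (a), (c) and (d) are stated
  for (\<lambda> - 1) Q(G).

  The signs can be compared because a piece of a non-separable graph becomes non-separable once an
  edge is added between its two attachment vertices, so it has exactly one block whatever the piece
  looked like. Only the pieces that occur without such an edge have an unknown number of blocks, and
  it is their parity that the alternatives prescribe.

  Membership in the family is up to isomorphism, since the label of an added edge is an arbitrary
  choice. Hence \<open>Qf\<close>, including its block count, has to be shown invariant under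
  isomorphism before the induction hypothesis can be applied.\<close>

text \<open>Depends on an end map and an edge set only, not on a graph: the expansion ranges over
  edge subsets, and gluing or identification changes just one of the two arguments.\<close>

definition conn :: "(nat \<Rightarrow> 'v uprod) \<Rightarrow> nat set \<Rightarrow> 'v \<Rightarrow> 'v \<Rightarrow> bool" where
  "conn g A = (\<lambda>x y. \<exists>e\<in>A. g e = Upair x y)\<^sup>*\<^sup>*"

lemma reach_conn: "reach G = conn (ends G) (edges G)"
  by (simp add: reach_def conn_def adj_def[abs_def])

lemma conn_refl [simp]: "conn g A x x"
  by (simp add: conn_def)

lemma conn_trans: "conn g A x y \<Longrightarrow> conn g A y z \<Longrightarrow> conn g A x z"
  unfolding conn_def by (rule rtranclp_trans)

lemma conn_sym:
  assumes "conn g A x y" shows "conn g A y x"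
proof -
  have "symp (\<lambda>x y. \<exists>e\<in>A. g e = Upair x y)"
  proof (rule sympI)
    fix x y assume "\<exists>e\<in>A. g e = Upair x y"
    moreover have "Upair x y = Upair y x" by simp
    ultimately show "\<exists>e\<in>A. g e = Upair y x" by simp
  qed
  from sympD[OF symp_rtranclp[OF this]] assms show ?thesis by (simp add: conn_def)
qed

lemma conn_commute: "conn g A x y \<longleftrightarrow> conn g A y x"
  by (intro iffI) (erule conn_sym)+

lemma conn_edge: "e \<in> A \<Longrightarrow> g e = Upair x y \<Longrightarrow> conn g A x y"
  unfolding conn_def by blast

text \<open>Used mostly with maps that collapse a part of the graph to a vertex: a walk is pushed
  through \<open>f\<close>, and each of its edges has to become a connection only, not an
  edge.\<close>

lemma conn_map:
  assumes "conn g A x y"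
    and "\<And>e a b. e \<in> A \<Longrightarrow> g e = Upair a b \<Longrightarrow> conn h B (f a) (f b)"
  shows "conn h B (f x) (f y)"
  using assms(1) unfolding conn_def[of g]
proof (induction rule: rtranclp_induct)
  case base
  show ?case by simp
next
  case (step y z)
  then obtain e where "e \<in> A" "g e = Upair y z" by blast
  then have "conn h B (f y) (f z)" by (rule assms(2))
  with step.IH show ?case by (rule conn_trans)
qed

lemma conn_mono: "conn g A x y \<Longrightarrow> A \<subseteq> B \<Longrightarrow> conn g B x y"
  by (rule conn_map[where f = "\<lambda>x. x"]) (auto intro: conn_edge)

lemma conn_cong:
  assumes "\<And>e. e \<in> A \<Longrightarrow> g e = h e"
  shows "conn g A = conn h A"
proof -
  have "(\<lambda>x y. \<exists>e\<in>A. g e = Upair x y) = (\<lambda>x y. \<exists>e\<in>A. h e = Upair x y)"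
    using assms by (auto simp: fun_eq_iff)
  then show ?thesis by (simp add: conn_def)
qed

lemma conn_closed:
  assumes "conn g A x y" "x \<in> W"
    and "\<And>e a b. e \<in> A \<Longrightarrow> g e = Upair a b \<Longrightarrow> a \<in> W \<Longrightarrow> b \<in> W"
  shows "y \<in> W"
  using assms(1,2) unfolding conn_def[of g]
  by (induction rule: rtranclp_induct) (auto intro: assms(3))

lemma conn_empty [simp]: "conn g {} x y \<longleftrightarrow> x = y"
  using conn_closed[of g "{}" x y "{x}"] by auto

text \<open>If \<open>C\<close> is the connectivity relation of an edge set, then \<open>via C p q\<close> is the one obtained
  after adding an edge \<open>pq\<close>; no edge label is needed to express this.\<close>

definition via :: "('v \<Rightarrow> 'v \<Rightarrow> bool) \<Rightarrow> 'v \<Rightarrow> 'v \<Rightarrow> 'v \<Rightarrow> 'v \<Rightarrow> bool" where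
  "via C p q x y \<longleftrightarrow> C x y \<or> C x p \<and> C q y \<or> C x q \<and> C p y"

lemma via_trans:
  assumes "via (conn g A) p q x y" "via (conn g A) p q y z"
  shows "via (conn g A) p q x z"
  using assms unfolding via_def by (meson conn_trans conn_sym)

lemma via_imp_conn:
  assumes "via C p q x y" "conn g B p q" "\<And>a b. C a b \<Longrightarrow> conn g B a b"
  shows "conn g B x y"
  using assms(1) unfolding via_def
proof (elim disjE conjE)
  assume "C x p" "C q y"
  then show ?thesis using assms(2,3) conn_trans[of g B] by blast
next
  assume "C x q" "C p y"
  then show ?thesis using assms(3) conn_sym[OF assms(2)] conn_trans[of g B] by blast
qed (rule assms(3))

lemma conn_insert:
  assumes "g e = Upair p q"
  shows "conn g (insert e A) x y \<longleftrightarrow> via (conn g A) p q x y"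
proof
  assume "conn g (insert e A) x y"
  then show "via (conn g A) p q x y" unfolding conn_def[of g "insert e A"]
  proof (induction rule: rtranclp_induct)
    case base
    show ?case by (simp add: via_def)
  next
    case (step y z)
    then obtain d where d: "d \<in> insert e A" "g d = Upair y z" by blast
    have "via (conn g A) p q y z"
    proof (cases "d = e")
      case True
      then have "y = p \<and> z = q \<or> y = q \<and> z = p" using d assms by auto
      then show ?thesis by (auto simp: via_def)
    next
      case False
      then show ?thesis using d by (auto simp: via_def intro: conn_edge)
    qed
    with step.IH show ?case by (rule via_trans)
  qed
next
  have pq: "conn g (insert e A) p q" by (rule conn_edge[of e]) (auto simp: assms)
  have m: "conn g A a b \<Longrightarrow> conn g (insert e A) a b" for a b by (rule conn_mono) auto
  assume "via (conn g A) p q x y"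
  then show "conn g (insert e A) x y" using pq m by (rule via_imp_conn)
qed

text \<open>Both sides count how much the nullity grows when \<open>ab\<close> and \<open>pq\<close> are added, in either
  order.\<close>

lemma via_exchange:
  "of_bool (conn g A a b) + of_bool (via (conn g A) a b p q)
   = (of_bool (conn g A p q) + of_bool (via (conn g A) p q a b) :: nat)"
proof -
  have *: "via (conn g A) a b p q \<longleftrightarrow> conn g A p q" if "conn g A a b" for a b p q
    using via_imp_conn[of "conn g A" a b p q g A] that by (auto simp: via_def)
  \<comment> \<open>With neither pair connected, both sides say that \<open>ab\<close> and
    \<open>pq\<close> join the same two components, which is symmetric in the two pairs.\<close>
  have "via (conn g A) a b p q \<longleftrightarrow> via (conn g A) p q a b"
    if "\<not> conn g A a b" "\<not> conn g A p q"
    using that conn_commute[of g A p a] conn_commute[of g A b q] conn_commute[of g A p b]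
      conn_commute[of g A a q] by (auto simp: via_def)
  moreover have "via (conn g A) p q a b" if "conn g A a b" using that by (simp add: via_def)
  moreover have "via (conn g A) a b p q" if "conn g A p q" using that by (simp add: via_def)
  ultimately show ?thesis
    using *[of a b p q] *[of p q a b] by (cases "conn g A a b"; cases "conn g A p q") simp_all
qed

section \<open>Nullity of edge sets\<close>

definition joined :: "(nat \<Rightarrow> 'v uprod) \<Rightarrow> nat set \<Rightarrow> nat \<Rightarrow> bool" where
  "joined g A e \<longleftrightarrow> (\<exists>p q. g e = Upair p q \<and> conn g A p q)"

lemma joined_iff: "g e = Upair p q \<Longrightarrow> joined g A e \<longleftrightarrow> conn g A p q"
  by (auto simp: joined_def dest: conn_sym)

text \<open>Inserting the edges in increasing order of their labels, the nullity counts those whose ends are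
  already connected; \<open>nul_insert\<close> shows that the order is irrelevant. This avoids counting
  components, hence any reference to the vertex set.\<close>

definition nul :: "(nat \<Rightarrow> 'v uprod) \<Rightarrow> nat set \<Rightarrow> nat" where
  "nul g A = card {e\<in>A. joined g {d\<in>A. d < e} e}"

lemma nul_empty [simp]: "nul g {} = 0"
  by (simp add: nul_def)

lemma nul_insert_max:
  assumes "finite A" "\<And>d. d \<in> A \<Longrightarrow> d < e" "g e = Upair p q"
  shows "nul g (insert e A) = nul g A + of_bool (conn g A p q)"
proof -
  have eA: "e \<notin> A" using assms(2) by blast
  have 1: "{c \<in> insert e A. c < d} = {c\<in>A. c < d}" if "d \<in> A" for d
    using assms(2)[OF that] by auto
  have 2: "{c \<in> insert e A. c < e} = A" using assms(2) by auto
  let ?B = "{d\<in>A. joined g {c\<in>A. c < d} d}"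
  have "{d \<in> insert e A. joined g {c \<in> insert e A. c < d} d}
     = ?B \<union> (if conn g A p q then {e} else {})"
  proof -
    define J where "J d = joined g {c \<in> insert e A. c < d} d" for d
    have "J d \<longleftrightarrow> joined g {c\<in>A. c < d} d" if "d \<in> A" for d
      unfolding J_def 1[OF that] ..
    then have "?B = {d\<in>A. J d}" by blast
    moreover have "J e \<longleftrightarrow> conn g A p q"
      unfolding J_def 2 using assms(3) by (rule joined_iff)
    ultimately show ?thesis unfolding J_def[symmetric] by auto
  qed
  moreover have "finite ?B" "e \<notin> ?B" using assms(1) eA by auto
  ultimately show ?thesis unfolding nul_def by simp
qed

text \<open>Induction on the largest label \<open>m\<close> of the set. If \<open>e\<close> is
  smaller than \<open>m\<close>, inserting \<open>m\<close> last is covered by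
  \<open>nul_insert_max\<close>, and \<open>via_exchange\<close> swaps the contributions of
  \<open>e\<close> and \<open>m\<close>.\<close>

lemma nul_insert:
  assumes "finite A" "e \<notin> A" "g e = Upair p q"
  shows "nul g (insert e A) = nul g A + of_bool (conn g A p q)"
  using assms
proof (induction A rule: finite_linorder_max_induct)
  case empty
  show ?case by (rule nul_insert_max) (use empty in auto)
next
  case (insert m A)
  show ?case
  proof (cases "m < e")
    case True
    show ?thesis
      by (rule nul_insert_max) (use insert True in force)+
  next
    case False
    then have em: "e < m" "e \<noteq> m" using insert.prems by auto
    obtain a b where ab: "g m = Upair a b" by (metis uprod_exhaust)
    have "nul g (insert e (insert m A)) = nul g (insert m (insert e A))"
      by (simp add: insert_commute)
    also have "\<dots> = nul g (insert e A) + of_bool (conn g (insert e A) a b)"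
      by (rule nul_insert_max) (use insert em ab in auto)
    also have "\<dots> = nul g A + of_bool (conn g A p q) + of_bool (via (conn g A) p q a b)"
      using insert em conn_insert[where g = g and e = e, OF insert.prems(2)] by simp
    also have "\<dots> = nul g A + of_bool (conn g A a b) + of_bool (via (conn g A) a b p q)"
      using via_exchange[of g A a b p q] by simp
    also have "nul g A + of_bool (conn g A a b) = nul g (insert m A)"
      by (rule nul_insert_max[symmetric]) (use insert ab in auto)
    finally show ?thesis using conn_insert[where g = g and e = m, OF ab] by simp
  qed
qed

lemma nul_cong:
  assumes "\<And>e. e \<in> A \<Longrightarrow> g e = h e"
  shows "nul g A = nul h A"
proof -
  have "conn g {d\<in>A. d < e} = conn h {d\<in>A. d < e}" for e
    by (rule conn_cong) (use assms in auto)
  then have "joined g {d\<in>A. d < e} e \<longleftrightarrow> joined h {d\<in>A. d < e} e" if "e \<in> A" for e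
    using assms[OF that] by (simp add: joined_def)
  then show ?thesis unfolding nul_def by (metis (mono_tags, lifting))
qed

text \<open>\<open>f\<close> is injective only on \<open>W\<close>, which contains all ends;
  connections are pulled back along \<open>inv_into W f\<close>. Nullity and connectivity of
  relabelled edge sets are both needed, the former being computed edge by edge from the
  latter.\<close>

lemma nul_image:
  assumes "finite A" "inj_on k A" "inj_on f W"
    and "\<And>e. e \<in> A \<Longrightarrow> h (k e) = map_uprod f (g e)"
    and "\<And>e. e \<in> A \<Longrightarrow> set_uprod (g e) \<subseteq> W"
  shows "nul h (k ` A) = nul g A
    \<and> (\<forall>a\<in>W. \<forall>b\<in>W. conn h (k ` A) (f a) (f b) \<longleftrightarrow> conn g A a b)"
proof -
  have conn_eq: "conn h (k ` B) (f a) (f b) \<longleftrightarrow> conn g B a b"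
    if "B \<subseteq> A" "a \<in> W" "b \<in> W" for B a b
  proof
    assume "conn g B a b"
    then show "conn h (k ` B) (f a) (f b)"
    proof (rule conn_map)
      fix e x y assume "e \<in> B" "g e = Upair x y"
      then show "conn h (k ` B) (f x) (f y)"
        using assms(4)[of e] that by (intro conn_edge[of "k e"]) auto
    qed
  next
    let ?i = "inv_into W f"
    assume "conn h (k ` B) (f a) (f b)"
    then have "conn g B (?i (f a)) (?i (f b))"
    proof (rule conn_map)
      fix e x y assume "e \<in> k ` B" "h e = Upair x y"
      then obtain d where d: "d \<in> B" "h (k d) = Upair x y" by blast
      obtain p q where pq: "g d = Upair p q" by (metis uprod_exhaust)
      then have "p \<in> W" "q \<in> W" using assms(5)[of d] d that by auto
      moreover have "Upair x y = Upair (f p) (f q)" using d pq assms(4)[of d] that by auto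
      ultimately have "g d = Upair (?i x) (?i y)"
        using pq assms(3) by (auto simp: inv_into_f_f)
      then show "conn g B (?i x) (?i y)" using d by (auto intro: conn_edge)
    qed
    then show "conn g B a b" using that assms(3) by (simp add: inv_into_f_f)
  qed
  have "nul h (k ` B) = nul g B" if "B \<subseteq> A" for B
    using finite_subset[OF that assms(1)] that
  proof (induction B rule: finite_induct)
    case (insert e B)
    obtain p q where pq: "g e = Upair p q" by (metis uprod_exhaust)
    then have "p \<in> W" "q \<in> W" using assms(5)[of e] insert.prems by auto
    moreover have "h (k e) = Upair (f p) (f q)" using assms(4)[of e] insert.prems pq by auto
    moreover have "k e \<notin> k ` B" using assms(2) insert by (auto dest: inj_onD)
    ultimately have "nul h (insert (k e) (k ` B)) = nul h (k ` B) + of_bool (conn h (k ` B) (f p) (f q))"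
      using insert.hyps by (intro nul_insert) auto
    also have "\<dots> = nul g B + of_bool (conn g B p q)"
      using insert conn_eq[of B p q] \<open>p \<in> W\<close> \<open>q \<in> W\<close> by simp
    also have "\<dots> = nul g (insert e B)"
      using nul_insert[where g = g, OF insert.hyps(1,2) pq] by simp
    finally show ?case by simp
  qed simp
  then show ?thesis using conn_eq by blast
qed

text \<open>Identifying \<open>u\<close> and \<open>v\<close> acts on connectivity like adding an
  edge \<open>uv\<close>, since every vertex is \<open>via\<close>-connected to its image.\<close>

lemma conn_identify:
  fixes u v :: 'v
  defines "f \<equiv> \<lambda>x. if x = v then u else x"
  shows "conn (\<lambda>e. map_uprod f (g e)) A (f a) (f b) \<longleftrightarrow> via (conn g A) u v a b"
proof
  have fx: "via (conn g A) u v x (f x)" "via (conn g A) u v (f x) x" for x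
    by (auto simp: via_def f_def)
  assume "conn (\<lambda>e. map_uprod f (g e)) A (f a) (f b)"
  then have "via (conn g A) u v (f a) (f b)" unfolding conn_def[of "\<lambda>e. map_uprod f (g e)"]
  proof (induction rule: rtranclp_induct)
    case base
    show ?case by (simp add: via_def)
  next
    case (step y z)
    then obtain e where e: "e \<in> A" "map_uprod f (g e) = Upair y z" by blast
    obtain p q where pq: "g e = Upair p q" by (metis uprod_exhaust)
    have "via (conn g A) u v p q" "via (conn g A) u v q p"
      using conn_edge[of e A g p q] e(1) pq conn_sym[of g A p q] by (auto simp: via_def)
    then have "via (conn g A) u v (f p) (f q)" "via (conn g A) u v (f q) (f p)"
      using fx via_trans by metis+
    then have "via (conn g A) u v y z" using e pq by auto
    with step.IH show ?case by (rule via_trans)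
  qed
  then show "via (conn g A) u v a b" using fx via_trans by metis
next
  let ?h = "\<lambda>e. map_uprod f (g e)"
  have c: "conn ?h A (f x) (f y)" if "conn g A x y" for x y
    using that by (rule conn_map) (auto intro: conn_edge)
  have "f u = f v" by (simp add: f_def)
  assume "via (conn g A) u v a b"
  then consider "conn g A a b" | "conn g A a u" "conn g A v b" | "conn g A a v" "conn g A u b"
    by (auto simp: via_def)
  then show "conn ?h A (f a) (f b)"
  proof cases
    case 1 then show ?thesis by (rule c)
  next
    case 2 then show ?thesis using c[of a u] c[of v b] \<open>f u = f v\<close> conn_trans by metis
  next
    case 3 then show ?thesis using c[of a v] c[of u b] \<open>f u = f v\<close> conn_trans by metis
  qed
qed

text \<open>Identification amounts to adding an edge \<open>uv\<close> and contracting it.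
  Contracting a non-loop preserves nullity, so only the added edge counts; formally,
  \<open>via_exchange\<close> moves it past each edge of the set.\<close>

lemma nul_identify:
  assumes "finite A" "u \<noteq> v"
  shows "nul (\<lambda>e. map_uprod (\<lambda>x. if x = v then u else x) (g e)) A
    = nul g A + of_bool (conn g A u v)"
  using assms(1)
proof (induction A rule: finite_induct)
  case empty
  then show ?case using assms by simp
next
  case (insert e A)
  obtain p q where pq: "g e = Upair p q" by (metis uprod_exhaust)
  let ?f = "\<lambda>x. if x = v then u else x"
  let ?h = "\<lambda>e. map_uprod ?f (g e)"
  have "nul ?h (insert e A) = nul ?h A + of_bool (conn ?h A (?f p) (?f q))"
    using insert pq by (intro nul_insert) auto
  also have "\<dots> = nul g A + of_bool (conn g A u v) + of_bool (via (conn g A) u v p q)"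
    using insert.IH conn_identify[of v u g A p q] by simp
  also have "\<dots> = nul g A + of_bool (conn g A p q) + of_bool (via (conn g A) p q u v)"
    using via_exchange[of g A u v p q] by simp
  also have "\<dots> = nul g (insert e A) + of_bool (conn g (insert e A) u v)"
    using nul_insert[where g = g, OF insert.hyps(1,2) pq] conn_insert[where g = g and e = e, OF pq] by simp
  finally show ?case .
qed

text \<open>Seen from \<open>W\<close>, the set \<open>A\<close> matters only through whether it
  connects \<open>u\<close> and \<open>v\<close>; if so, it acts like one edge
  \<open>uv\<close>.\<close>

lemma conn_glue:
  assumes "\<And>e. e \<in> A \<Longrightarrow> set_uprod (g e) \<subseteq> V" "\<And>e. e \<in> B \<Longrightarrow> set_uprod (g e) \<subseteq> W"
    and "V \<inter> W \<subseteq> {u, v}" and "a \<in> W" "b \<in> W"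
  shows "conn g (A \<union> B) a b \<longleftrightarrow>
    (if conn g A u v then via (conn g B) u v a b else conn g B a b)" (is "?L \<longleftrightarrow> ?R")
proof
  let ?P = "\<lambda>x y. if conn g A u v then via (conn g B) u v x y else conn g B x y"
  \<comment> \<open>A retraction onto \<open>W\<close>: a vertex outside goes to \<open>v\<close> if
    \<open>A\<close> connects it to \<open>v\<close>, else to \<open>u\<close>. If \<open>A\<close>
    does not connect \<open>u\<close> and \<open>v\<close>, the ends of an edge of \<open>A\<close>
    thus have the same image.\<close>
  let ?f = "\<lambda>x. if x \<in> W then x else if conn g A x v then v else u"
  have tr: "?P x z" if "?P x y" "?P y z" for x y z
    using that via_trans[of g B u v x y z] conn_trans[of g B x y z] by (cases "conn g A u v") simp_all
  assume ?L
  then have "?P (?f a) (?f b)" unfolding conn_def[of g "A \<union> B"]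
  proof (induction rule: rtranclp_induct)
    case base
    show ?case by (simp add: via_def)
  next
    case (step y z)
    then obtain e where e: "e \<in> A \<union> B" "g e = Upair y z" by blast
    have "?P (?f y) (?f z)"
    proof (cases "e \<in> A")
      case True
      then have yz: "y \<in> V" "z \<in> V" "conn g A y z" "conn g A z y"
        using assms(1)[of e] e by (auto intro: conn_edge conn_sym)
      have r: "?f x \<in> {u, v}" if "x \<in> V" for x using that assms(3) by auto
      show ?thesis
      proof (cases "conn g A u v")
        case True
        then show ?thesis using r[OF yz(1)] r[OF yz(2)] by (auto simp: via_def)
      next
        case False
        have "?f x = (if conn g A x v then v else u)" if "x \<in> V" for x
          using that assms(3) False by (cases "x \<in> W") auto
        then show ?thesis
          using yz False conn_trans[of g A y z v] conn_trans[of g A z y v] by auto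
      qed
    next
      case False
      then have "y \<in> W" "z \<in> W" "conn g B y z" using assms(2)[of e] e by (auto intro: conn_edge)
      then show ?thesis by (simp add: via_def)
    qed
    with step.IH show ?case by (rule tr)
  qed
  moreover have "?f a = a" "?f b = b" using assms(4,5) by simp_all
  ultimately show ?R by (simp only:)
next
  have m: "conn g B x y \<Longrightarrow> conn g (A \<union> B) x y" "conn g A x y \<Longrightarrow> conn g (A \<union> B) x y" for x y
    by (auto elim: conn_mono)
  assume ?R
  then show ?L
    using m via_imp_conn[of "conn g B" u v a b g "A \<union> B"] by (cases "conn g A u v") simp_all
qed

text \<open>A new cycle arises exactly when both sides connect \<open>u\<close> and
  \<open>v\<close>. The term for \<open>u = v\<close> makes the formula cover one-vertex gluings
  too: there both connections are trivial and the two indicators cancel.\<close>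

lemma nul_glue:
  assumes "finite A" "finite B" "A \<inter> B = {}"
    and "\<And>e. e \<in> A \<Longrightarrow> set_uprod (g e) \<subseteq> V" "\<And>e. e \<in> B \<Longrightarrow> set_uprod (g e) \<subseteq> W"
    and "V \<inter> W \<subseteq> {u, v}"
  shows "nul g (A \<union> B) + of_bool (u = v)
    = nul g A + nul g B + of_bool (conn g A u v \<and> conn g B u v)"
  using assms(2,3,5)
proof (induction B rule: finite_induct)
  case empty
  then show ?case by auto
next
  case (insert e B)
  obtain p q where pq: "g e = Upair p q" by (metis uprod_exhaust)
  then have W: "p \<in> W" "q \<in> W" using insert.prems(2)[of e] by auto
  have eAB: "e \<notin> A \<union> B" using insert by auto
  have IH: "nul g (A \<union> B) + of_bool (u = v)
    = nul g A + nul g B + of_bool (conn g A u v \<and> conn g B u v)"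
    using insert by auto
  have c: "conn g (A \<union> B) p q \<longleftrightarrow>
    (if conn g A u v then via (conn g B) u v p q else conn g B p q)"
    by (rule conn_glue[OF assms(4) _ assms(6)]) (use insert W in auto)
  have "nul g (A \<union> insert e B) = nul g (A \<union> B) + of_bool (conn g (A \<union> B) p q)"
    using nul_insert[where g = g, OF _ eAB pq] insert.hyps assms(1) by simp
  moreover have "nul g (insert e B) = nul g B + of_bool (conn g B p q)"
    using nul_insert[where g = g, OF _ _ pq] insert.hyps by simp
  moreover have "of_bool (conn g (A \<union> B) p q) + of_bool (conn g A u v \<and> conn g B u v)
      = (of_bool (conn g B p q) + of_bool (conn g A u v \<and> conn g (insert e B) u v) :: nat)"
    using via_exchange[of g B p q u v]
    by (cases "conn g A u v") (simp_all only: c conn_insert[where g = g and e = e, OF pq] if_True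
        if_False simp_thms of_bool_eq add.commute)
  ultimately show ?case using IH by linarith
qed


section \<open>The subset expansion of the flow polynomial\<close>

definition wt :: "(nat \<Rightarrow> 'v uprod) \<Rightarrow> nat set \<Rightarrow> nat set \<Rightarrow> real poly" where
  "wt g E A = (-1) ^ card (E - A) * [:0, 1:] ^ nul g A"

definition fsum :: "(nat \<Rightarrow> 'v uprod) \<Rightarrow> nat set \<Rightarrow> real poly" where
  "fsum g E = (\<Sum>A\<in>Pow E. wt g E A)"

definition csum :: "(nat \<Rightarrow> 'v uprod) \<Rightarrow> nat set \<Rightarrow> 'v \<Rightarrow> 'v \<Rightarrow> real poly" where
  "csum g E u v = (\<Sum>A\<in>Pow E. of_bool (conn g A u v) * wt g E A)"

text \<open>The source of every factor \<lambda> - 1: \<open>[:0, 1:]\<close> is \<lambda> and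
  \<open>[:-1, 1:]\<close> is \<lambda> - 1.\<close>

lemma power_add_of_bool:
  "([:0, 1:] :: real poly) ^ (n + of_bool b) = [:0, 1:] ^ n * (1 + [:-1, 1:] * of_bool b)"
  by (cases b) (simp_all add: one_pCons)

lemma sum_Pow_insert:
  fixes h :: "'a set \<Rightarrow> 'b::comm_monoid_add"
  assumes "finite E" "e \<notin> E"
  shows "(\<Sum>A\<in>Pow (insert e E). h A) = (\<Sum>A\<in>Pow E. h A + h (insert e A))"
proof -
  have "inj_on (insert e) (Pow E)" using assms(2) by (auto simp: inj_on_def)
  moreover have "Pow E \<inter> insert e ` Pow E = {}" using assms(2) by auto
  ultimately show ?thesis
    using assms(1) by (simp add: Pow_insert sum.union_disjoint sum.reindex sum.distrib)
qed

lemma sum_Pow_Un: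
  fixes h :: "'a set \<Rightarrow> 'b::comm_monoid_add"
  assumes "E \<inter> F = {}"
  shows "(\<Sum>A\<in>Pow (E \<union> F). h A) = (\<Sum>A\<in>Pow E. \<Sum>B\<in>Pow F. h (A \<union> B))"
proof -
  have "bij_betw (\<lambda>(A, B). A \<union> B) (Pow E \<times> Pow F) (Pow (E \<union> F))"
    by (rule bij_betw_byWitness[where f' = "\<lambda>C. (C \<inter> E, C \<inter> F)"]) (use assms in auto)
  then have "(\<Sum>C\<in>Pow (E \<union> F). h C) = (\<Sum>(A, B)\<in>Pow E \<times> Pow F. h (A \<union> B))"
    by (simp add: case_prod_beta flip: sum.reindex_bij_betw[where h = "\<lambda>(A, B). A \<union> B"])
  then show ?thesis by (simp add: sum.cartesian_product)
qed

lemma wt_insert: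
  assumes "finite E" "e \<notin> E" "A \<subseteq> E"
  shows "wt g (insert e E) A = - wt g E A"
    and "g e = Upair p q \<Longrightarrow> wt g (insert e E) (insert e A)
      = wt g E A * (1 + [:-1, 1:] * of_bool (conn g A p q))"
proof -
  have "insert e E - A = insert e (E - A)" using assms by auto
  then show "wt g (insert e E) A = - wt g E A" using assms by (simp add: wt_def)
  have "insert e E - insert e A = E - A" using assms by auto
  moreover assume "g e = Upair p q"
  then have "nul g (insert e A) = nul g A + of_bool (conn g A p q)"
    using assms by (intro nul_insert) (auto intro: finite_subset)
  ultimately show "wt g (insert e E) (insert e A)
      = wt g E A * (1 + [:-1, 1:] * of_bool (conn g A p q))"
    by (simp only: wt_def power_add_of_bool mult.assoc)
qed

lemma fsum_empty [simp]: "fsum g {} = 1"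
  by (simp add: fsum_def wt_def)

text \<open>The terms of \<open>A\<close> and \<open>insert e A\<close> have opposite signs and
  cancel unless \<open>A\<close> connects the ends of \<open>e\<close>; then the second carries an
  extra \<lambda>.\<close>

lemma fsum_insert:
  assumes "finite E" "e \<notin> E" "g e = Upair p q"
  shows "fsum g (insert e E) = [:-1, 1:] * csum g E p q"
proof -
  have "fsum g (insert e E) = (\<Sum>A\<in>Pow E. [:-1, 1:] * (of_bool (conn g A p q) * wt g E A))"
    unfolding fsum_def sum_Pow_insert[OF assms(1,2)]
  proof (rule sum.cong[OF refl])
    fix A assume "A \<in> Pow E"
    then have A: "A \<subseteq> E" by simp
    show "wt g (insert e E) A + wt g (insert e E) (insert e A)
      = [:-1, 1:] * (of_bool (conn g A p q) * wt g E A)"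
      unfolding wt_insert(1)[OF assms(1,2) A] wt_insert(2)[where g = g, OF assms(1,2) A assms(3)]
      by (cases "conn g A p q") (simp_all add: algebra_simps)
  qed
  then show ?thesis by (simp only: csum_def sum_distrib_left)
qed

text \<open>Every \<open>insert e A\<close> connects the ends, while \<open>A\<close> counts
  negatively if it does so itself; this leaves 1, plus \<lambda> - 2 when \<open>A\<close> connects
  them. The formula serves the second parallel edge in (d).\<close>

lemma csum_insert:
  assumes "finite E" "e \<notin> E" "g e = Upair p q"
  shows "csum g (insert e E) p q = fsum g E + ([:-1, 1:] - 1) * csum g E p q"
proof -
  have "csum g (insert e E) p q
      = (\<Sum>A\<in>Pow E. wt g E A + ([:-1, 1:] - 1) * (of_bool (conn g A p q) * wt g E A))"
    unfolding csum_def sum_Pow_insert[OF assms(1,2)]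
  proof (rule sum.cong[OF refl])
    fix A assume "A \<in> Pow E"
    then have A: "A \<subseteq> E" by simp
    have "conn g (insert e A) p q" by (rule conn_edge[of e]) (use assms in auto)
    then show "of_bool (conn g A p q) * wt g (insert e E) A
        + of_bool (conn g (insert e A) p q) * wt g (insert e E) (insert e A)
      = wt g E A + ([:-1, 1:] - 1) * (of_bool (conn g A p q) * wt g E A)"
      unfolding wt_insert(1)[OF assms(1,2) A] wt_insert(2)[where g = g, OF assms(1,2) A assms(3)]
      by (cases "conn g A p q") (simp_all add: algebra_simps)
  qed
  then show ?thesis by (simp only: csum_def fsum_def sum_distrib_left sum.distrib)
qed

lemma csum_refl: "csum g E v v = fsum g E"
  by (simp add: csum_def fsum_def)

lemma csum_not_conn:
  assumes "\<not> conn g E u v"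
  shows "csum g E u v = 0"
  unfolding csum_def using assms by (intro sum.neutral) (auto dest: conn_mono)

lemma wt_cong:
  assumes "\<And>e. e \<in> A \<Longrightarrow> g e = h e"
  shows "wt g E A = wt h E A"
  using nul_cong[OF assms] by (simp add: wt_def)

lemma fsum_cong:
  assumes "\<And>e. e \<in> E \<Longrightarrow> g e = h e"
  shows "fsum g E = fsum h E"
  unfolding fsum_def by (rule sum.cong[OF refl], rule wt_cong) (use assms in auto)

lemma csum_cong:
  assumes "\<And>e. e \<in> E \<Longrightarrow> g e = h e"
  shows "csum g E u v = csum h E u v"
  unfolding csum_def
proof (rule sum.cong[OF refl])
  fix A assume "A \<in> Pow E"
  then have "conn g A = conn h A" "wt g E A = wt h E A"
    using assms by (auto intro!: conn_cong wt_cong)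
  then show "of_bool (conn g A u v) * wt g E A = of_bool (conn h A u v) * wt h E A" by simp
qed

lemma fsum_image:
  assumes "finite E" "inj_on k E" "inj_on f W"
    and "\<And>e. e \<in> E \<Longrightarrow> h (k e) = map_uprod f (g e)"
    and "\<And>e. e \<in> E \<Longrightarrow> set_uprod (g e) \<subseteq> W"
  shows "fsum h (k ` E) = fsum g E"
proof -
  have "fsum h (k ` E) = (\<Sum>A\<in>Pow E. wt h (k ` E) (k ` A))"
    unfolding fsum_def image_Pow_surj[OF refl, symmetric]
    by (rule sum.reindex[unfolded comp_def]) (rule inj_on_image_Pow[OF assms(2)])
  also have "\<dots> = fsum g E" unfolding fsum_def
  proof (rule sum.cong[OF refl])
    fix A assume "A \<in> Pow E"
    then have A: "A \<subseteq> E" by simp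
    have "k ` E - k ` A = k ` (E - A)"
      by (rule inj_on_image_set_diff[OF assms(2), symmetric]) (use A in auto)
    then have "card (k ` E - k ` A) = card (E - A)"
      using inj_on_subset[OF assms(2), of "E - A"] by (simp add: card_image)
    moreover have "nul h (k ` A) = nul g A"
      using A assms finite_subset[OF A assms(1)] inj_on_subset[OF assms(2) A]
      by (intro nul_image[THEN conjunct1, of A k f W]) auto
    ultimately show "wt h (k ` E) (k ` A) = wt g E A" by (simp add: wt_def)
  qed
  finally show ?thesis .
qed

lemma fsum_identify:
  assumes "finite E" "u \<noteq> v"
  shows "fsum (\<lambda>e. map_uprod (\<lambda>x. if x = v then u else x) (g e)) E
    = fsum g E + [:-1, 1:] * csum g E u v"
proof -
  let ?h = "\<lambda>e. map_uprod (\<lambda>x. if x = v then u else x) (g e)"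
  have "fsum ?h E = (\<Sum>A\<in>Pow E. wt g E A + [:-1, 1:] * (of_bool (conn g A u v) * wt g E A))"
    unfolding fsum_def
  proof (rule sum.cong[OF refl])
    fix A assume "A \<in> Pow E"
    then have "finite A" using assms(1) by (auto intro: finite_subset)
    then show "wt ?h E A = wt g E A + [:-1, 1:] * (of_bool (conn g A u v) * wt g E A)"
      using nul_identify[where g = g, OF _ assms(2)]
      by (simp only: wt_def power_add_of_bool algebra_simps)
  qed
  then show ?thesis by (simp only: csum_def fsum_def sum_distrib_left sum.distrib)
qed

lemma wt_Un:
  assumes "finite E" "finite F" "E \<inter> F = {}" "A \<subseteq> E" "B \<subseteq> F"
    and "nul g (A \<union> B) = nul g A + nul g B + of_bool c"
  shows "wt g (E \<union> F) (A \<union> B) = wt g E A * wt g F B * (1 + [:-1, 1:] * of_bool c)"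
proof -
  have "E \<union> F - (A \<union> B) = (E - A) \<union> (F - B)" using assms by auto
  moreover have "card ((E - A) \<union> (F - B)) = card (E - A) + card (F - B)"
    using assms by (intro card_Un_disjoint) auto
  ultimately have "card (E \<union> F - (A \<union> B)) = card (E - A) + card (F - B)" by simp
  then show ?thesis
    unfolding wt_def assms(6) power_add_of_bool by (simp only: power_add mult.assoc mult.left_commute)
qed

lemma fsum_glue_one:
  assumes "finite E" "finite F" "E \<inter> F = {}"
    and "\<And>e. e \<in> E \<Longrightarrow> set_uprod (g e) \<subseteq> V" "\<And>e. e \<in> F \<Longrightarrow> set_uprod (g e) \<subseteq> W"
    and "V \<inter> W \<subseteq> {v}"
  shows "fsum g (E \<union> F) = fsum g E * fsum g F"
    and "u \<in> V \<Longrightarrow> w \<in> W \<Longrightarrow> v \<in> V \<Longrightarrow> v \<in> W \<Longrightarrow>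
      csum g (E \<union> F) u w = csum g E v u * csum g F v w"
proof -
  have wt: "wt g (E \<union> F) (A \<union> B) = wt g E A * wt g F B" if "A \<subseteq> E" "B \<subseteq> F" for A B
  proof -
    \<comment> \<open>The two-vertex formula with both vertices equal to \<open>v\<close>, so that
      nullity is additive.\<close>
    have "nul g (A \<union> B) + of_bool (v = v)
        = nul g A + nul g B + of_bool (conn g A v v \<and> conn g B v v)"
    proof (rule nul_glue[where V = V and W = W])
      show "finite A" "finite B" "A \<inter> B = {}"
        using that assms(1-3) by (auto intro: finite_subset)
    qed (use that assms(4-6) in blast)+
    then show ?thesis
      using wt_Un[of E F A B g False] assms(1-3) that by simp
  qed
  show "fsum g (E \<union> F) = fsum g E * fsum g F"
    unfolding fsum_def sum_Pow_Un[OF assms(3)] sum_product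
    by (intro sum.cong refl) (simp add: wt)
  assume uw: "u \<in> V" "w \<in> W" "v \<in> V" "v \<in> W"
  have c: "conn g (A \<union> B) u w \<longleftrightarrow> conn g A v u \<and> conn g B v w" if "A \<subseteq> E" "B \<subseteq> F" for A B
  proof
    assume *: "conn g (A \<union> B) u w"
    \<comment> \<open>Two retractions, each collapsing the opposite side to \<open>v\<close>; they
      turn a walk from \<open>u\<close> to \<open>w\<close> into a walk from \<open>u\<close> to
      \<open>v\<close> on one side and from \<open>v\<close> to \<open>w\<close> on the
      other.\<close>
    let ?f = "\<lambda>x. if x \<in> V then x else v" and ?h = "\<lambda>x. if x \<in> W then x else v"
    have "conn g A (?f u) (?f w)" using *
    proof (rule conn_map)
      fix e a b assume e: "e \<in> A \<union> B" "g e = Upair a b"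
      show "conn g A (?f a) (?f b)"
      proof (cases "e \<in> A")
        case True
        then show ?thesis using assms(4)[of e] that e by (auto intro: conn_edge)
      next
        case False
        then have "a \<in> W" "b \<in> W" using assms(5)[of e] that e by auto
        then have "?f a = v" "?f b = v" using assms(6) by auto
        then show ?thesis by simp
      qed
    qed
    moreover have "?f w = v" using uw assms(6) by auto
    moreover have "conn g B (?h u) (?h w)" using *
    proof (rule conn_map)
      fix e a b assume e: "e \<in> A \<union> B" "g e = Upair a b"
      show "conn g B (?h a) (?h b)"
      proof (cases "e \<in> B")
        case True
        then show ?thesis using assms(5)[of e] that e by (auto intro: conn_edge)
      next
        case False
        then have "a \<in> V" "b \<in> V" using assms(4)[of e] that e by auto
        then have "?h a = v" "?h b = v" using assms(6) by auto
        then show ?thesis by simp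
      qed
    qed
    moreover have "?h u = v" using uw assms(6) by auto
    ultimately show "conn g A v u \<and> conn g B v w" using uw by (simp add: conn_sym)
  next
    assume "conn g A v u \<and> conn g B v w"
    then have "conn g (A \<union> B) u v" "conn g (A \<union> B) v w" by (auto intro: conn_mono conn_sym)
    then show "conn g (A \<union> B) u w" by (rule conn_trans)
  qed
  show "csum g (E \<union> F) u w = csum g E v u * csum g F v w"
    unfolding csum_def sum_Pow_Un[OF assms(3)] sum_product
    by (intro sum.cong refl) (simp add: wt c of_bool_conj mult_ac)
qed

lemma fsum_glue_two:
  assumes "finite E" "finite F" "E \<inter> F = {}"
    and "\<And>e. e \<in> E \<Longrightarrow> set_uprod (g e) \<subseteq> V" "\<And>e. e \<in> F \<Longrightarrow> set_uprod (g e) \<subseteq> W"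
    and "V \<inter> W \<subseteq> {u, v}" "u \<noteq> v"
  shows "fsum g (E \<union> F) = fsum g E * fsum g F + [:-1, 1:] * (csum g E u v * csum g F u v)"
proof -
  have "wt g (E \<union> F) (A \<union> B) = wt g E A * wt g F B
      + [:-1, 1:] * ((of_bool (conn g A u v) * wt g E A) * (of_bool (conn g B u v) * wt g F B))"
    if "A \<subseteq> E" "B \<subseteq> F" for A B
  proof -
    have "nul g (A \<union> B) + of_bool (u = v)
        = nul g A + nul g B + of_bool (conn g A u v \<and> conn g B u v)"
    proof (rule nul_glue[where V = V and W = W])
      show "finite A" "finite B" "A \<inter> B = {}"
        using that assms(1-3) by (auto intro: finite_subset)
    qed (use that assms(4-6) in blast)+
    then have "wt g (E \<union> F) (A \<union> B)
        = wt g E A * wt g F B * (1 + [:-1, 1:] * of_bool (conn g A u v \<and> conn g B u v))"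
      using assms that by (intro wt_Un) auto
    then show ?thesis by (cases "conn g A u v"; cases "conn g B u v") (simp_all add: algebra_simps)
  qed
  then have "fsum g (E \<union> F) = (\<Sum>A\<in>Pow E. \<Sum>B\<in>Pow F. wt g E A * wt g F B
      + [:-1, 1:] * ((of_bool (conn g A u v) * wt g E A) * (of_bool (conn g B u v) * wt g F B)))"
    unfolding fsum_def sum_Pow_Un[OF assms(3)] by (intro sum.cong refl) blast
  moreover have "fsum g E * fsum g F = (\<Sum>A\<in>Pow E. \<Sum>B\<in>Pow F. wt g E A * wt g F B)"
    by (simp only: fsum_def sum_product)
  moreover have "csum g E u v * csum g F u v = (\<Sum>A\<in>Pow E. \<Sum>B\<in>Pow F.
      (of_bool (conn g A u v) * wt g E A) * (of_bool (conn g B u v) * wt g F B))"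
    by (simp only: csum_def sum_product)
  ultimately show ?thesis by (simp only: sum.distrib sum_distrib_left)
qed

section \<open>Existence and uniqueness of the flow polynomial\<close>

lemma wf_graph_delete_edge: "wf_graph G \<Longrightarrow> wf_graph (delete_edge G e)"
  by (auto simp: wf_graph_def delete_edge_def)

lemma wf_graph_identify: "wf_graph G \<Longrightarrow> wf_graph (identify G u v)"
  by (auto simp: wf_graph_def identify_def Let_def uprod.set_map)

text \<open>\<open>contract\<close> orders the two ends by a choice; this exposes the chosen
  order.\<close>

lemma contract_eq:
  obtains a b where "ends G e = Upair a b" "contract G e = identify (delete_edge G e) a b"
proof -
  let ?P = "\<lambda>p. ends G e = Upair (fst p) (snd p)"
  obtain a b where "ends G e = Upair a b" by (metis uprod_exhaust)
  then have "?P (a, b)" by simp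
  then have "?P (Eps ?P)" by (rule someI)
  then show ?thesis by (rule that) (simp add: contract_def Let_def)
qed

text \<open>The value 0 on ill-formed graphs is the one that \<open>flow_rules\<close> prescribes,
  which pins down the function on the whole type.\<close>

definition flow_sum :: "'v graph \<Rightarrow> real poly" where
  "flow_sum G = (if wf_graph G then fsum (ends G) (edges G) else 0)"

text \<open>Bridges give 0 because no set of the remaining edges joins their ends; disjoint unions
  are gluings along nothing; a loop joins its ends under every subset; and the contraction rule
  compares \<open>fsum_insert\<close> with \<open>fsum_identify\<close>.\<close>

lemma flow_rules_flow_sum: "flow_rules (flow_sum :: 'v graph \<Rightarrow> real poly)"
proof -
  have bridge: "flow_sum G = 0" if wf: "wf_graph G" and br: "is_bridge G e" for G :: "'v graph" and e
  proof -
    obtain a b where e: "e \<in> edges G" "ends G e = Upair a b" "\<not> reach (delete_edge G e) a b"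
      using br unfolding is_bridge_def by blast
    have "fsum (ends G) (insert e (edges G - {e})) = [:-1, 1:] * csum (ends G) (edges G - {e}) a b"
      by (rule fsum_insert) (use wf e in \<open>auto simp: wf_graph_def\<close>)
    then show ?thesis
      using e wf by (simp add: flow_sum_def csum_not_conn reach_conn delete_edge_def insert_absorb)
  qed
  have union: "flow_sum (disjoint_union G H) = flow_sum G * flow_sum H"
    if "wf_graph G" "wf_graph H" "verts G \<inter> verts H = {}" "edges G \<inter> edges H = {}"
    for G H :: "'v graph"
  proof -
    let ?g = "\<lambda>e. if e \<in> edges G then ends G e else ends H e"
    have "fsum ?g (edges G \<union> edges H) = fsum ?g (edges G) * fsum ?g (edges H)"
      by (rule fsum_glue_one[where V = "verts G" and W = "verts H"])
        (use that in \<open>auto simp: wf_graph_def\<close>)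
    also have "fsum ?g (edges G) = fsum (ends G) (edges G)" by (rule fsum_cong) simp
    also have "fsum ?g (edges H) = fsum (ends H) (edges H)" by (rule fsum_cong) (use that in auto)
    finally have "fsum ?g (edges G \<union> edges H) = fsum (ends G) (edges G) * fsum (ends H) (edges H)" .
    moreover have "wf_graph (disjoint_union G H)"
      using that by (auto simp: wf_graph_def disjoint_union_def)
    ultimately show ?thesis using that by (simp add: flow_sum_def disjoint_union_def)
  qed
  have del: "flow_sum G = [:-1, 1:] * csum (ends G) (edges G - {e}) a b"
    if "wf_graph G" "e \<in> edges G" "ends G e = Upair a b" for G :: "'v graph" and e a b
    using fsum_insert[of "edges G - {e}" e "ends G" a b] that
    by (simp add: flow_sum_def insert_absorb wf_graph_def)
  have loop: "flow_sum G = [:-1, 1:] * flow_sum (delete_edge G e)"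
    if wf: "wf_graph G" and e: "e \<in> edges G" "is_loop G e" for G :: "'v graph" and e
  proof -
    obtain v where "ends G e = Upair v v" using e by (auto simp: is_loop_def)
    from del[OF wf e(1) this] show ?thesis
      using wf_graph_delete_edge[OF wf] by (simp add: csum_refl flow_sum_def delete_edge_def)
  qed
  have contr: "flow_sum G = flow_sum (contract G e) - flow_sum (delete_edge G e)"
    if wf: "wf_graph G" and e: "e \<in> edges G" "\<not> is_loop G e" for G :: "'v graph" and e
  proof -
    obtain a b where ab: "ends G e = Upair a b" "contract G e = identify (delete_edge G e) a b"
      by (rule contract_eq)
    then have "a \<noteq> b" using e by (auto simp: is_loop_def)
    moreover have "finite (edges G - {e})" using wf by (simp add: wf_graph_def)
    moreover have "wf_graph (delete_edge G e)" "wf_graph (identify (delete_edge G e) a b)"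
      by (intro wf_graph_identify wf_graph_delete_edge wf)+
    moreover have "edges (identify (delete_edge G e) a b) = edges G - {e}"
      "ends (identify (delete_edge G e) a b)
        = (\<lambda>d. map_uprod (\<lambda>x. if x = b then a else x) (ends G d))"
      "edges (delete_edge G e) = edges G - {e}" "ends (delete_edge G e) = ends G"
      by (simp_all add: identify_def Let_def delete_edge_def)
    ultimately have "flow_sum (contract G e) = flow_sum (delete_edge G e)
        + [:-1, 1:] * csum (ends G) (edges G - {e}) a b"
      using fsum_identify[of "edges G - {e}" a b "ends G"]
      by (simp only: flow_sum_def ab(2) if_True simp_thms)
    then show ?thesis using del[OF wf e(1) ab(1)] by simp
  qed
  show ?thesis
    unfolding flow_rules_def
    using bridge union loop contr by (auto simp: flow_sum_def)
qed

lemma flow_rules_unique: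
  assumes f: "flow_rules f" and h: "flow_rules h"
  shows "f G = h G"
proof (induction "card (edges G)" arbitrary: G rule: less_induct)
  case less
  note F = f[unfolded flow_rules_def] and H = h[unfolded flow_rules_def]
  consider "\<not> wf_graph G" | "wf_graph G" "edges G = {}" | "wf_graph G" "\<exists>e. is_bridge G e"
    | e where "wf_graph G" "e \<in> edges G" "\<not> (\<exists>e. is_bridge G e)" by blast
  then show ?case
  proof cases
    case 1 then show ?thesis using F H by simp
  next
    case 2 then show ?thesis using F H by simp
  next
    case 3 then show ?thesis using F H by simp
  next
    case 4
    then have "card (edges G - {e}) < card (edges G)"
      by (intro card_Diff1_less) (auto simp: wf_graph_def)
    moreover have "edges (delete_edge G e) = edges G - {e}" by (simp add: delete_edge_def)
    moreover have "edges (contract G e) = edges G - {e}"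
      by (simp add: contract_def identify_def Let_def delete_edge_def)
    ultimately have IH: "f (delete_edge G e) = h (delete_edge G e)" "f (contract G e) = h (contract G e)"
      using less[of "delete_edge G e"] less[of "contract G e"] by simp_all
    show ?thesis
    proof (cases "is_loop G e")
      case True
      then have "f G = [:-1, 1:] * f (delete_edge G e)" "h G = [:-1, 1:] * h (delete_edge G e)"
        using F H 4 by blast+
      then show ?thesis using IH by simp
    next
      case False
      then have "f G = f (contract G e) - f (delete_edge G e)"
        "h G = h (contract G e) - h (delete_edge G e)"
        using F H 4 by blast+
      then show ?thesis using IH by simp
    qed
  qed
qed

lemma flow_poly_eq: "flow_poly = flow_sum"
  unfolding flow_poly_def
proof (rule the_equality)
  show "flow_rules (flow_sum :: 'a graph \<Rightarrow> _)" by (rule flow_rules_flow_sum)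
  then show "f = flow_sum" if "flow_rules f" for f :: "'a graph \<Rightarrow> _"
    using flow_rules_unique[of f flow_sum] that by blast
qed

lemma flow_poly_fsum: "wf_graph G \<Longrightarrow> flow_poly G = fsum (ends G) (edges G)"
  by (simp add: flow_poly_eq flow_sum_def)


section \<open>Blocks and one-vertex gluings\<close>

lemma graph_eqI: "verts G = verts H \<Longrightarrow> edges G = edges H \<Longrightarrow> ends G = ends H \<Longrightarrow> G = (H :: 'v graph)"
  by simp

lemma subgraph_refl: "wf_graph G \<Longrightarrow> subgraph G G"
  by (simp add: subgraph_def)

lemma subgraph_trans: "subgraph G H \<Longrightarrow> subgraph H K \<Longrightarrow> subgraph G K"
  by (auto simp: subgraph_def)

lemma wf_graph_ends_subset: "wf_graph G \<Longrightarrow> e \<in> edges G \<Longrightarrow> set_uprod (ends G e) \<subseteq> verts G"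
  by (simp add: wf_graph_def)

lemma wf_graph_endsD:
  assumes "wf_graph G" "e \<in> edges G" "ends G e = Upair a b"
  shows "a \<in> verts G" "b \<in> verts G"
  using assms by (force simp: wf_graph_def)+

text \<open>With a set as argument, connectivity of the graph (empty set) and of the graph minus a
  vertex (singleton) are instances of one notion.\<close>

definition avoiding :: "'v graph \<Rightarrow> 'v set \<Rightarrow> nat set" where
  "avoiding G X = {e\<in>edges G. set_uprod (ends G e) \<inter> X = {}}"

lemma avoiding_empty [simp]: "avoiding G {} = edges G"
  by (simp add: avoiding_def)

lemma reach_delete_vertex: "reach (delete_vertex G w) = conn (ends G) (avoiding G {w})"
  by (simp add: reach_conn delete_vertex_def avoiding_def)

lemma connected_graph_conn:
  "connected_graph G \<longleftrightarrow>
    verts G \<noteq> {} \<and> (\<forall>x\<in>verts G. \<forall>y\<in>verts G. conn (ends G) (edges G) x y)"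
  by (simp add: connected_graph_def reach_conn)

text \<open>Stated with at most one component, because deleting the only vertex leaves a graph with
  none.\<close>

lemma ncomp_le_one_iff:
  assumes "finite (verts G)"
  shows "ncomp G \<le> 1 \<longleftrightarrow> (\<forall>x\<in>verts G. \<forall>y\<in>verts G. reach G x y)"
proof -
  let ?r = "{(x, y). x \<in> verts G \<and> y \<in> verts G \<and> reach G x y}"
  have fin: "finite (verts G // ?r)"
    unfolding quotient_def using assms by simp
  show ?thesis
  proof
    assume "ncomp G \<le> 1"
    then have le: "card (verts G // ?r) \<le> 1" by (simp add: ncomp_def)
    show "\<forall>x\<in>verts G. \<forall>y\<in>verts G. reach G x y"
    proof (intro ballI)
      fix x y assume xy: "x \<in> verts G" "y \<in> verts G"
      have "?r `` {x} = ?r `` {y}"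
      proof (rule card_le_Suc0_iff_eq[THEN iffD1, OF fin, rule_format])
        show "card (verts G // ?r) \<le> Suc 0" using le by simp
        show "?r `` {x} \<in> verts G // ?r" "?r `` {y} \<in> verts G // ?r"
          using xy by (simp_all only: quotientI)
      qed
      moreover have "y \<in> ?r `` {y}" using xy by (simp add: reach_conn)
      ultimately have "y \<in> ?r `` {x}" by simp
      then show "reach G x y" by simp
    qed
  next
    assume "\<forall>x\<in>verts G. \<forall>y\<in>verts G. reach G x y"
    then have "?r `` {x} = verts G" if "x \<in> verts G" for x using that by auto
    then have "verts G // ?r \<subseteq> {verts G}" by (auto simp: quotient_def)
    then have "card (verts G // ?r) \<le> card {verts G}" by (intro card_mono) auto
    then show "ncomp G \<le> 1" by (simp add: ncomp_def)
  qed
qed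

lemma ncomp_connected:
  assumes "wf_graph G" "connected_graph G"
  shows "ncomp G = 1"
proof -
  let ?r = "{(x, y). x \<in> verts G \<and> y \<in> verts G \<and> reach G x y}"
  have fin: "finite (verts G // ?r)"
    unfolding quotient_def using assms by (simp add: wf_graph_def)
  have "ncomp G \<le> 1"
    using assms by (subst ncomp_le_one_iff) (auto simp: wf_graph_def connected_graph_def)
  moreover have "verts G // ?r \<noteq> {}"
    using assms by (auto simp: quotient_def connected_graph_def)
  then have "ncomp G \<noteq> 0" using fin by (simp add: ncomp_def)
  ultimately show ?thesis by simp
qed

lemma cut_vertex_iff:
  assumes "wf_graph G" "connected_graph G"
  shows "cut_vertex G v \<longleftrightarrow> v \<in> verts G \<and>
    \<not> (\<forall>x\<in>verts G - {v}. \<forall>y\<in>verts G - {v}. conn (ends G) (avoiding G {v}) x y)"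
proof -
  have "finite (verts (delete_vertex G v))"
    using assms by (simp add: wf_graph_def delete_vertex_def)
  from ncomp_le_one_iff[OF this]
  have "ncomp (delete_vertex G v) \<le> 1 \<longleftrightarrow>
      (\<forall>x\<in>verts G - {v}. \<forall>y\<in>verts G - {v}. conn (ends G) (avoiding G {v}) x y)"
    by (simp add: reach_delete_vertex) (simp add: delete_vertex_def)
  then show ?thesis
    unfolding cut_vertex_def ncomp_connected[OF assms] by (simp only: not_le[symmetric])
qed

lemma non_separable_iff:
  assumes "wf_graph G"
  shows "non_separable G \<longleftrightarrow> connected_graph G \<and>
    (\<forall>v\<in>verts G. \<forall>x\<in>verts G - {v}. \<forall>y\<in>verts G - {v}. conn (ends G) (avoiding G {v}) x y) \<and>
    ((\<forall>e\<in>edges G. \<not> is_loop G e) \<or> card (verts G) = 1 \<and> card (edges G) = 1)"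
  unfolding non_separable_def using cut_vertex_iff[OF assms] by blast

lemma non_separable_conn:
  assumes "wf_graph G" "non_separable G" "x \<in> verts G" "y \<in> verts G" "x \<noteq> v" "y \<noteq> v"
  shows "conn (ends G) (avoiding G {v}) x y"
proof (cases "v \<in> verts G")
  case True
  then show ?thesis using assms by (simp add: non_separable_iff)
next
  case False
  then have "avoiding G {v} = edges G"
    using assms(1) by (auto simp: avoiding_def wf_graph_def)
  then show ?thesis using assms by (simp add: non_separable_def connected_graph_conn)
qed

text \<open>If both sides had edges, there would be two edges and hence no loops, so each side would
  contain a vertex other than \<open>v\<close>. A walk avoiding \<open>v\<close> between these two
  vertices cannot leave \<open>V - {v}\<close>.\<close>

lemma non_separable_one_side:
  assumes "wf_graph G" "non_separable G" "edges G = E \<union> F" "E \<inter> F = {}"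
    and "\<And>e. e \<in> E \<Longrightarrow> set_uprod (ends G e) \<subseteq> V" "\<And>e. e \<in> F \<Longrightarrow> set_uprod (ends G e) \<subseteq> W"
    and "V \<inter> W \<subseteq> {v}"
  shows "E = {} \<or> F = {}"
proof (rule ccontr)
  assume "\<not> (E = {} \<or> F = {})"
  then obtain c d where cd: "c \<in> E" "d \<in> F" by blast
  have "finite (edges G)" using assms(1) by (simp add: wf_graph_def)
  then have "card {c, d} \<le> card (edges G)" using cd assms(3) by (intro card_mono) auto
  moreover have "c \<noteq> d" using cd assms(4) by auto
  ultimately have "card (edges G) \<noteq> 1" by simp
  then have nl: "\<not> is_loop G e" if "e \<in> edges G" for e
    using that assms(2) by (auto simp: non_separable_def)
  have ex: "\<exists>x\<in>set_uprod (ends G e). x \<noteq> v" if "e \<in> edges G" for e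
  proof -
    obtain a b where ab: "ends G e = Upair a b" by (metis uprod_exhaust)
    then have "a \<noteq> b" using nl[OF that] by (auto simp: is_loop_def)
    then show ?thesis using ab by (cases "a = v") auto
  qed
  obtain x where x: "x \<in> set_uprod (ends G c)" "x \<noteq> v" using ex[of c] cd assms(3) by blast
  obtain y where y: "y \<in> set_uprod (ends G d)" "y \<noteq> v" using ex[of d] cd assms(3) by blast
  have xy: "x \<in> verts G" "y \<in> verts G"
    using assms(1,3) x y cd by (auto simp: wf_graph_def)
  have xV: "x \<in> V" using x cd assms(5) by blast
  have "conn (ends G) (avoiding G {v}) x y"
    by (rule non_separable_conn[OF assms(1,2) xy]) (use x y in auto)
  then have "y \<in> V - {v}"
  proof (rule conn_closed)
    show "x \<in> V - {v}" using x xV by simp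
    fix e a b assume e: "e \<in> avoiding G {v}" "ends G e = Upair a b" "a \<in> V - {v}"
    then have "b \<noteq> v" "e \<in> E \<union> F" using assms(3) by (auto simp: avoiding_def)
    moreover have "e \<notin> F" using assms(6)[of e] assms(7) e by auto
    ultimately have "e \<in> E" "b \<noteq> v" by auto
    then show "b \<in> V - {v}" using assms(5)[of e] e by auto
  qed
  moreover have "y \<in> W" using y cd assms(6) by blast
  ultimately show False using assms(7) y by auto
qed

lemma is_block_subgraph: "is_block G H \<Longrightarrow> subgraph H G"
  by (simp add: is_block_def)

lemma finite_subgraphs:
  assumes "wf_graph (G :: 'v graph)"
  shows "finite {H. subgraph H G}"
proof (rule finite_subset)
  show "{H. subgraph H G} \<subseteq>
      (\<lambda>(V, E). \<lparr>verts = V, edges = E, ends = ends G\<rparr>) ` (Pow (verts G) \<times> Pow (edges G))"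
  proof
    fix H assume "H \<in> {H. subgraph H G}"
    then have "H = \<lparr>verts = verts H, edges = edges H, ends = ends G\<rparr>"
      "verts H \<subseteq> verts G" "edges H \<subseteq> edges G"
      by (auto simp: subgraph_def)
    then show "H \<in> (\<lambda>(V, E). \<lparr>verts = V, edges = E, ends = ends G\<rparr>) ` (Pow (verts G) \<times> Pow (edges G))"
      by (intro image_eqI[of _ _ "(verts H, edges H)"]) auto
  qed
qed (use assms in \<open>auto simp: wf_graph_def\<close>)

lemma blocks_non_separable:
  assumes "wf_graph G" "non_separable G"
  shows "is_block G H \<longleftrightarrow> H = G"
  using assms subgraph_refl[OF assms(1)]
  unfolding is_block_def
  by (metis graph_eqI subgraph_def subset_antisym)

lemma nblocks_non_separable:
  assumes "wf_graph G" "non_separable G" "edges G \<noteq> {}"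
  shows "nblocks G = 1"
proof -
  have "{H. is_block G H \<and> edges H \<noteq> {}} = {G}"
    using blocks_non_separable[OF assms(1,2)] assms(3) by auto
  then show ?thesis by (simp add: nblocks_def)
qed

text \<open>The integer exponent |E| - |V| + b - 1 has the parity opposite to |E| + |V| + b, so an
  even sum gives the sign -1.\<close>

lemma Qf_eq:
  assumes "wf_graph G"
  shows "Qf G x = (if even (card (edges G) + card (verts G) + nblocks G) then - 1 else 1)
    * poly (fsum (ends G) (edges G)) x"
proof -
  have "even (pexp G) \<longleftrightarrow> odd (card (edges G) + card (verts G) + nblocks G)"
    by (simp add: pexp_def)
  then show ?thesis
    using assms by (simp add: Qf_def flow_poly_fsum power_int_minus_left)
qed

lemma wf_graph_nonempty_edge_ends:
  assumes "wf_graph G" "connected_graph G" "edges G \<noteq> {}" "x \<in> verts G"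
  shows "\<exists>e\<in>edges G. x \<in> set_uprod (ends G e)"
proof (rule ccontr)
  assume no: "\<not> ?thesis"
  obtain e where e: "e \<in> edges G" using assms(3) by auto
  obtain a b where ab: "ends G e = Upair a b" by (metis uprod_exhaust)
  have "conn (ends G) (edges G) x a"
    using assms wf_graph_endsD(1)[OF assms(1) e ab] by (simp add: connected_graph_conn)
  then have "a \<in> {x}"
  proof (rule conn_closed)
    fix d y z assume "d \<in> edges G" "ends G d = Upair y z" "y \<in> {x}"
    then show "z \<in> {x}" using no by auto
  qed simp
  then show False using no e ab by auto
qed

section \<open>Graphs glued at one vertex\<close>

definition one_sum :: "'v graph \<Rightarrow> 'v \<Rightarrow> 'v graph \<Rightarrow> 'v graph \<Rightarrow> bool" where
  "one_sum G v H K \<longleftrightarrow> subgraph H G \<and> subgraph K G \<and> edges H \<inter> edges K = {} \<and>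
     edges H \<union> edges K = edges G \<and> verts H \<inter> verts K = {v} \<and> verts H \<union> verts K = verts G"

lemma one_sum_commute: "one_sum G v H K \<Longrightarrow> one_sum G v K H"
  by (auto simp: one_sum_def)

lemma one_sum_connected:
  assumes "connected_graph G" "one_sum G v H K"
  shows "connected_graph H"
proof -
  let ?f = "\<lambda>x. if x \<in> verts H then x else v"
  have sub: "wf_graph H" "wf_graph K" "ends H = ends G" "ends K = ends G"
    using assms(2) by (auto simp: one_sum_def subgraph_def)
  have "conn (ends H) (edges H) x y" if xy: "x \<in> verts H" "y \<in> verts H" for x y
  proof -
    have "conn (ends G) (edges G) x y"
      using assms(1) xy assms(2)[unfolded one_sum_def subgraph_def]
      by (auto simp only: connected_graph_conn subset_iff)
    then have "conn (ends H) (edges H) (?f x) (?f y)"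
    proof (rule conn_map)
      fix e a b assume e: "e \<in> edges G" "ends G e = Upair a b"
      show "conn (ends H) (edges H) (?f a) (?f b)"
      proof (cases "e \<in> edges H")
        case True
        then show ?thesis
          using e wf_graph_endsD[OF sub(1) True] sub by (auto intro: conn_edge)
      next
        case False
        then have "e \<in> edges K" using e assms(2) by (auto simp: one_sum_def)
        then have "a \<in> verts K" "b \<in> verts K" using wf_graph_endsD[OF sub(2)] e sub by auto
        then have "?f a = v" "?f b = v" using assms(2) by (auto simp: one_sum_def)
        then show ?thesis by simp
      qed
    qed
    then show ?thesis using xy by simp
  qed
  moreover have "verts H \<noteq> {}" using assms(2) by (auto simp: one_sum_def)
  ultimately show ?thesis by (simp add: connected_graph_conn)
qed

text \<open>By \<open>non_separable_one_side\<close> all edges of \<open>B\<close> lie in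
  \<open>H\<close>; the vertices follow, since a connected graph with an edge has no isolated
  vertices.\<close>

lemma one_sum_non_separable_subgraph:
  assumes "one_sum G v H K" "subgraph B G" "non_separable B" "edges B \<inter> edges H \<noteq> {}"
  shows "subgraph B H"
proof -
  note os = assms(1)[unfolded one_sum_def subgraph_def]
  have B: "wf_graph B" "ends B = ends G" "edges B \<subseteq> edges G"
    using assms(2) by (auto simp: subgraph_def)
  have "edges B \<inter> edges H = {} \<or> edges B \<inter> edges K = {}"
  proof (rule non_separable_one_side[OF B(1) assms(3), where V = "verts H" and W = "verts K" and v = v])
    fix e
    show "e \<in> edges B \<inter> edges H \<Longrightarrow> set_uprod (ends B e) \<subseteq> verts H"
      "e \<in> edges B \<inter> edges K \<Longrightarrow> set_uprod (ends B e) \<subseteq> verts K"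
      using os B(2) wf_graph_ends_subset[of H e] wf_graph_ends_subset[of K e] by simp_all
  qed (use os B(3) in blast)+
  then have E: "edges B \<subseteq> edges H" using assms(4) os B(3) by blast
  have "x \<in> verts H" if x: "x \<in> verts B" for x
  proof -
    have "connected_graph B" using assms(3) by (simp add: non_separable_def)
    then obtain e where "e \<in> edges B" "x \<in> set_uprod (ends B e)"
      using wf_graph_nonempty_edge_ends[OF B(1) _ _ x] assms(4) by blast
    then have "e \<in> edges H" "x \<in> set_uprod (ends H e)" using E B(2) os by auto
    then show ?thesis using os wf_graph_ends_subset[of H e] by blast
  qed
  then show ?thesis using E B os by (auto simp: subgraph_def)
qed

text \<open>A non-separable graph containing \<open>B\<close> still has an edge in \<open>H\<close>,
  so it lies in \<open>H\<close>. Maximality in \<open>G\<close> and in \<open>H\<close> therefore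
  involves the same competitors.\<close>

lemma one_sum_is_block:
  assumes "one_sum G v H K" "edges B \<inter> edges H \<noteq> {}"
  shows "is_block G B \<longleftrightarrow> is_block H B"
proof -
  have HG: "subgraph H G" using assms(1) by (simp add: one_sum_def)
  note 1 = one_sum_non_separable_subgraph[OF assms(1)]
  have "subgraph B' H \<longleftrightarrow> subgraph B' G" if "subgraph B B'" "non_separable B'" for B'
  proof -
    have "edges B' \<inter> edges H \<noteq> {}" using that(1) assms(2) by (auto simp: subgraph_def)
    then show ?thesis using 1[OF _ that(2)] subgraph_trans[OF _ HG] by blast
  qed
  moreover have "subgraph B H \<longleftrightarrow> subgraph B G" if "non_separable B"
    using 1[OF _ that assms(2)] subgraph_trans[OF _ HG] by blast
  ultimately show ?thesis unfolding is_block_def by blast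
qed

lemma one_sum_blocks:
  assumes "one_sum G v H K"
  shows "{B. is_block G B \<and> edges B \<noteq> {}}
    = {B. is_block H B \<and> edges B \<noteq> {}} \<union> {B. is_block K B \<and> edges B \<noteq> {}}"
proof -
  have G: "edges B \<inter> edges H \<noteq> {} \<or> edges B \<inter> edges K \<noteq> {}"
    if "is_block G B" "edges B \<noteq> {}" for B
    using that assms by (auto simp: is_block_def subgraph_def one_sum_def)
  have HK: "edges B \<inter> edges H \<noteq> {}" if "is_block H B" "edges B \<noteq> {}" for B H :: "'a graph"
    using that by (auto simp: is_block_def subgraph_def)
  show ?thesis
    using one_sum_is_block[OF assms] one_sum_is_block[OF one_sum_commute[OF assms]] G HK by blast
qed

lemma one_sum_nblocks:
  assumes "one_sum G v H K"
  shows "nblocks G = nblocks H + nblocks K"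
proof -
  have wf: "wf_graph H" "wf_graph K" using assms by (auto simp: one_sum_def subgraph_def)
  have "{B. is_block H B \<and> edges B \<noteq> {}} \<inter> {B. is_block K B \<and> edges B \<noteq> {}} = {}"
  proof (rule equals0I)
    fix B assume "B \<in> {B. is_block H B \<and> edges B \<noteq> {}} \<inter> {B. is_block K B \<and> edges B \<noteq> {}}"
    then have "subgraph B H" "subgraph B K" "edges B \<noteq> {}" by (simp_all add: is_block_subgraph)
    moreover have "edges H \<inter> edges K = {}" using assms by (simp add: one_sum_def)
    ultimately show False unfolding subgraph_def by blast
  qed
  moreover have "finite {B. is_block L B \<and> edges B \<noteq> {}}" if "wf_graph L" for L :: "'a graph"
    using finite_subgraphs[OF that] by (rule finite_subset[rotated]) (blast dest: is_block_subgraph)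
  ultimately show ?thesis
    unfolding nblocks_def one_sum_blocks[OF assms] using wf by (intro card_Un_disjoint) auto
qed

text \<open>Edges and blocks add up while one vertex is shared, so p(G) = p(H) + p(K) + 2 and the
  signs multiply.\<close>

lemma one_sum_Qf:
  assumes "wf_graph G" "one_sum G v H K"
  shows "Qf G x = Qf H x * Qf K x"
proof -
  note os = assms(2)[unfolded one_sum_def subgraph_def]
  have fin: "finite (edges H)" "finite (edges K)" "finite (verts H)" "finite (verts K)"
    using os by (auto simp: wf_graph_def)
  have "card (edges G) = card (edges H) + card (edges K)"
    using card_Un_disjoint[of "edges H" "edges K"] fin os by simp
  moreover have "card (verts G) + 1 = card (verts H) + card (verts K)"
    using card_Un_Int[of "verts H" "verts K"] fin os by simp
  moreover have "fsum (ends G) (edges H \<union> edges K) = fsum (ends G) (edges H) * fsum (ends G) (edges K)"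
    by (rule fsum_glue_one[where V = "verts H" and W = "verts K" and v = v])
      (use os fin wf_graph_ends_subset[of H] wf_graph_ends_subset[of K] in auto)
  then have "fsum (ends G) (edges G) = fsum (ends H) (edges H) * fsum (ends K) (edges K)"
    using os by simp
  moreover have par: "even g \<longleftrightarrow> even (h + k + 1)" if "g + 1 = h + k" for g h k :: nat
    using that by presburger
  have "even (card (edges G) + card (verts G) + nblocks G) \<longleftrightarrow>
    even ((card (edges H) + card (verts H) + nblocks H) + (card (edges K) + card (verts K) + nblocks K) + 1)"
    by (rule par) (use calculation one_sum_nblocks[OF assms(2)] in simp)
  ultimately show ?thesis
    using Qf_eq[OF assms(1), of x] Qf_eq[of H x] Qf_eq[of K x] os by auto
qed


lemma cut_vertex_one_sum:
  assumes "wf_graph G" "connected_graph G" "cut_vertex G v"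
  obtains H K where "one_sum G v H K" "edges H \<noteq> {}" "edges K \<noteq> {}"
proof -
  obtain x y where xy: "x \<in> verts G" "y \<in> verts G" "x \<noteq> v" "y \<noteq> v"
    and nc: "\<not> conn (ends G) (avoiding G {v}) x y" and v: "v \<in> verts G"
    using assms(3) cut_vertex_iff[OF assms(1,2)] by blast
  \<comment> \<open>The component of \<open>x\<close> in \<open>G - v\<close>. \<open>H\<close>
    receives every edge meeting it, and loops at \<open>v\<close> go to \<open>K\<close>. Both sides
    have edges because \<open>x\<close> and \<open>y\<close> must still reach
    \<open>v\<close>.\<close>
  define C where "C = {z\<in>verts G. z \<noteq> v \<and> conn (ends G) (avoiding G {v}) x z}"
  define E where "E = {e\<in>edges G. set_uprod (ends G e) \<inter> C \<noteq> {}}"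
  define H where "H = G\<lparr>verts := insert v C, edges := E\<rparr>"
  define K where "K = G\<lparr>verts := verts G - C, edges := edges G - E\<rparr>"
  have C: "C \<subseteq> verts G" "v \<notin> C" "x \<in> C" "y \<notin> C" using xy nc by (auto simp: C_def)
  have fin: "finite (verts G)" "finite (edges G)" using assms(1) by (auto simp: wf_graph_def)
  have step: "b \<in> insert v C" if e: "e \<in> edges G" "ends G e = Upair a b" "a \<in> C" for e a b
  proof (cases "b = v")
    case False
    then have "e \<in> avoiding G {v}" using e C(2) by (auto simp: avoiding_def)
    then have "conn (ends G) (avoiding G {v}) a b" using e(2) by (rule conn_edge)
    then have "conn (ends G) (avoiding G {v}) x b"
      using e(3) conn_trans[of _ _ x a b] by (simp add: C_def)
    then show ?thesis using wf_graph_endsD(2)[OF assms(1) e(1,2)] False by (simp add: C_def)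
  qed simp
  have "set_uprod (ends G e) \<subseteq> insert v C" if e: "e \<in> E" for e
  proof -
    obtain a b where ab: "ends G e = Upair a b" by (metis uprod_exhaust)
    have ba: "ends G e = Upair b a" using ab by simp
    have "e \<in> edges G" using e by (simp add: E_def)
    then show ?thesis using step[OF _ ab] step[OF _ ba] e ab by (auto simp: E_def)
  qed
  then have "wf_graph H"
    using fin C(1) finite_subset[OF C(1)] by (simp add: wf_graph_def H_def E_def)
  moreover have "set_uprod (ends G e) \<subseteq> verts G - C" if "e \<in> edges G - E" for e
    using that wf_graph_ends_subset[OF assms(1), of e] by (auto simp: E_def)
  then have "wf_graph K" using fin by (simp add: wf_graph_def K_def)
  ultimately have os: "one_sum G v H K"
    using C v by (auto simp: one_sum_def subgraph_def H_def K_def E_def)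
  have "connected_graph H" "connected_graph K"
    using one_sum_connected[OF assms(2)] os one_sum_commute[OF os] by blast+
  then have "conn (ends H) (edges H) x v" "conn (ends K) (edges K) y v"
    using C xy v by (simp_all add: connected_graph_conn H_def K_def)
  then have "edges H \<noteq> {}" "edges K \<noteq> {}" using xy by auto
  with os show ?thesis by (rule that)
qed

lemma separable_one_sum:
  assumes "wf_graph G" "connected_graph G" "\<not> non_separable G"
  obtains v H K where "one_sum G v H K" "edges H \<noteq> {}" "edges K \<noteq> {}"
proof (cases "\<exists>v. cut_vertex G v")
  case True
  then obtain v where "cut_vertex G v" by blast
  then show ?thesis using cut_vertex_one_sum[OF assms(1,2)] that by metis
next
  case False
  then obtain e where e: "e \<in> edges G" "is_loop G e" and ne: "\<not> (card (verts G) = 1 \<and> card (edges G) = 1)"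
    using assms(2,3) unfolding non_separable_def by blast
  obtain v where v: "ends G e = Upair v v" using e(2) by (auto simp: is_loop_def)
  have vG: "v \<in> verts G" by (rule wf_graph_endsD(1)[OF assms(1) e(1) v])
  define H where "H = G\<lparr>verts := {v}, edges := {e}\<rparr>"
  have os: "one_sum G v H (delete_edge G e)"
    using wf_graph_delete_edge[OF assms(1), of e] vG v e(1)
    by (auto simp: one_sum_def subgraph_def H_def delete_edge_def wf_graph_def)
  \<comment> \<open>Without a cut-vertex some loop makes the graph separable, and it is split off at
    its vertex. Were it the only edge, connectedness would leave just the one-vertex loop, which
    counts as non-separable.\<close>
  have "edges G \<noteq> {e}"
  proof
    assume E: "edges G = {e}"
    have "verts G \<subseteq> {v}"
    proof
      fix x assume "x \<in> verts G"
      then obtain d where "d \<in> edges G" "x \<in> set_uprod (ends G d)"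
        using wf_graph_nonempty_edge_ends[OF assms(1,2)] e(1) by blast
      then show "x \<in> {v}" using E v by simp
    qed
    then have "verts G = {v}" using vG by blast
    then show False using ne E by simp
  qed
  then have "edges (delete_edge G e) \<noteq> {}" using e(1) by (auto simp: delete_edge_def)
  moreover have "edges H \<noteq> {}" by (simp add: H_def)
  ultimately show ?thesis using os that by blast
qed

lemma nblocks_edgeless: "edges G = {} \<Longrightarrow> nblocks G = 0"
proof -
  assume "edges G = {}"
  then have "{B. is_block G B \<and> edges B \<noteq> {}} = {}"
    using is_block_subgraph[of G] unfolding subgraph_def by blast
  then show ?thesis by (simp only: nblocks_def card.empty)
qed

text \<open>Such a graph is a single vertex without counted blocks, so p = -2 and the sign is
  positive.\<close>

lemma Qf_edgeless:
  assumes "wf_graph G" "connected_graph G" "edges G = {}"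
  shows "Qf G x = 1"
proof -
  have "is_singleton (verts G)"
    by (rule is_singletonI') (use assms(2,3) in \<open>simp_all add: connected_graph_conn\<close>)
  then have "card (verts G) = 1" by (simp add: is_singleton_altdef)
  moreover have "nblocks G = 0" using assms(3) by (rule nblocks_edgeless)
  ultimately show ?thesis using assms(3) by (simp add: Qf_eq[OF assms(1)])
qed

text \<open>Repeated splitting with \<open>one_sum_Qf\<close> replaces a product formula over the
  set of all blocks; every block of a part that has an edge is a block of the whole.\<close>

lemma Qf_pos_if_blocks_pos:
  assumes "wf_graph G" "connected_graph G"
    and "\<And>B. is_block G B \<Longrightarrow> edges B \<noteq> {} \<Longrightarrow> Qf B x > 0"
  shows "Qf G x > 0"
  using assms
proof (induction "card (edges G)" arbitrary: G rule: less_induct)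
  case less
  consider "edges G = {}" | "edges G \<noteq> {}" "non_separable G" | "\<not> non_separable G" by blast
  then show ?case
  proof cases
    case 1
    then show ?thesis using Qf_edgeless[OF less.prems(1,2)] by simp
  next
    case 2
    then show ?thesis using less.prems(3)[of G] blocks_non_separable[OF less.prems(1)] by simp
  next
    case 3
    then obtain v H K where os: "one_sum G v H K" and ne: "edges H \<noteq> {}" "edges K \<noteq> {}"
      using separable_one_sum[OF less.prems(1,2)] by metis
    have *: "Qf H x > 0" if os: "one_sum G v H K" and ne: "edges K \<noteq> {}" for H K
    proof (rule less.hyps)
      have "edges H \<subset> edges G" using os ne by (auto simp: one_sum_def)
      then show "card (edges H) < card (edges G)"
        using less.prems(1) by (intro psubset_card_mono) (auto simp: wf_graph_def)
      show "wf_graph H" using os by (simp add: one_sum_def subgraph_def)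
      show "connected_graph H" by (rule one_sum_connected[OF less.prems(2) os])
      fix B assume B: "is_block H B" "edges B \<noteq> {}"
      then have "edges B \<inter> edges H \<noteq> {}"
        using is_block_subgraph[OF B(1)] unfolding subgraph_def by blast
      then show "Qf B x > 0" using one_sum_is_block[OF os] B less.prems(3) by blast
    qed
    show ?thesis
      using *[OF os ne(2)] *[OF one_sum_commute[OF os] ne(1)] one_sum_Qf[OF less.prems(1) os] by simp
  qed
qed

section \<open>Adding edges to parts of non-separable graphs\<close>

lemma add_edge_cases:
  assumes "finite (edges G)"
  obtains n where "n \<notin> edges G" "edges (add_edge G u v) = insert n (edges G)"
    "verts (add_edge G u v) = verts G" "ends (add_edge G u v) = (ends G)(n := Upair u v)"
proof -
  define n where "n = (LEAST n. n \<notin> edges G)"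
  have "\<exists>n. n \<notin> edges G" using assms ex_new_if_finite infinite_UNIV_nat by blast
  then have "n \<notin> edges G" unfolding n_def by (rule LeastI_ex)
  then show ?thesis by (rule that) (simp_all add: add_edge_def Let_def n_def)
qed

lemma wf_graph_add_edge:
  assumes "wf_graph G" "u \<in> verts G" "v \<in> verts G"
  shows "wf_graph (add_edge G u v)"
proof -
  obtain n where "n \<notin> edges G" "edges (add_edge G u v) = insert n (edges G)"
    "verts (add_edge G u v) = verts G" "ends (add_edge G u v) = (ends G)(n := Upair u v)"
    by (rule add_edge_cases) (use assms in \<open>auto simp: wf_graph_def\<close>)
  then show ?thesis using assms by (simp add: wf_graph_def)
qed

lemma card_edges_add_edge: "finite (edges G) \<Longrightarrow> card (edges (add_edge G u v)) = Suc (card (edges G))"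
  by (rule add_edge_cases[of G u v]) simp_all

lemma verts_add_edge [simp]: "verts (add_edge G u v) = verts G"
  by (simp add: add_edge_def Let_def)

lemma fsum_add_edge:
  assumes "finite (edges G)"
  shows "fsum (ends (add_edge G u v)) (edges (add_edge G u v))
      = [:-1, 1:] * csum (ends G) (edges G) u v"
    and "csum (ends (add_edge G u v)) (edges (add_edge G u v)) u v
      = fsum (ends G) (edges G) + ([:-1, 1:] - 1) * csum (ends G) (edges G) u v"
proof -
  obtain n where n: "n \<notin> edges G" "edges (add_edge G u v) = insert n (edges G)"
    "ends (add_edge G u v) = (ends G)(n := Upair u v)"
    using assms by (rule add_edge_cases)
  let ?g = "(ends G)(n := Upair u v)"
  have c: "csum ?g (edges G) u v = csum (ends G) (edges G) u v"
    by (rule csum_cong) (use n in auto)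
  have f: "fsum ?g (edges G) = fsum (ends G) (edges G)"
    by (rule fsum_cong) (use n in auto)
  show "fsum (ends (add_edge G u v)) (edges (add_edge G u v))
      = [:-1, 1:] * csum (ends G) (edges G) u v"
    unfolding n(2,3) c[symmetric] using assms n(1) by (intro fsum_insert) simp_all
  show "csum (ends (add_edge G u v)) (edges (add_edge G u v)) u v
      = fsum (ends G) (edges G) + ([:-1, 1:] - 1) * csum (ends G) (edges G) u v"
    unfolding n(2,3) c[symmetric] f[symmetric] using assms n(1) by (intro csum_insert) simp_all
qed

text \<open>Paths of \<open>G\<close> that avoid a vertex project to \<open>H + uv\<close>: everything outside \<open>H\<close>
  is mapped to \<open>u\<close>, or to \<open>v\<close> if \<open>u\<close> is the vertex to be avoided.\<close>

lemma non_separable_add_edge: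
  assumes G: "wf_graph G" "non_separable G" and H: "subgraph H G"
    and uv: "u \<in> verts H" "v \<in> verts H" "u \<noteq> v"
    and W: "\<And>e. e \<in> edges G - edges H \<Longrightarrow> set_uprod (ends G e) \<subseteq> W" "verts H \<inter> W \<subseteq> {u, v}"
    and nl: "\<And>e. e \<in> edges H \<Longrightarrow> \<not> is_loop G e"
  shows "non_separable (add_edge H u v)"
proof -
  have wfH: "wf_graph H" and HG: "verts H \<subseteq> verts G" "edges H \<subseteq> edges G" "ends H = ends G"
    using H by (auto simp: subgraph_def)
  let ?K = "add_edge H u v"
  obtain n where n: "n \<notin> edges H" "edges ?K = insert n (edges H)"
    "verts ?K = verts H" "ends ?K = (ends G)(n := Upair u v)"
    using wfH HG(3) add_edge_cases[of H u v] by (auto simp: wf_graph_def)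
  \<comment> \<open>The empty \<open>X\<close> yields connectedness, a singleton the absence of
    cut-vertices. The new edge is used only if neither of its ends is in \<open>X\<close>; otherwise
    everything outside \<open>H\<close> lands on the one remaining end.\<close>
  have proj: "conn (ends ?K) (avoiding ?K X) x y"
    if c: "conn (ends G) (avoiding G X) x y" and X: "x \<in> verts H" "y \<in> verts H" "\<not> {u, v} \<subseteq> X"
    for X x y
  proof -
    let ?f = "\<lambda>z. if z \<in> verts H then z else if u \<in> X then v else u"
    have "conn (ends ?K) (avoiding ?K X) (?f x) (?f y)" using c
    proof (rule conn_map)
      fix e a b assume e: "e \<in> avoiding G X" "ends G e = Upair a b"
      then have eG: "e \<in> edges G" "a \<notin> X" "b \<notin> X" by (auto simp: avoiding_def)
      show "conn (ends ?K) (avoiding ?K X) (?f a) (?f b)"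
      proof (cases "e \<in> edges H")
        case True
        then have "a \<in> verts H" "b \<in> verts H"
          using wf_graph_endsD[OF wfH True, of a b] e(2) HG(3) by simp_all
        moreover have "conn (ends ?K) (avoiding ?K X) a b"
          by (rule conn_edge[of e]) (use True e n in \<open>auto simp: avoiding_def\<close>)
        ultimately show ?thesis by simp
      next
        case False
        then have ab: "a \<in> W" "b \<in> W" using W(1)[of e] eG e(2) by auto
        have f: "?f z \<in> {u, v} - X" if "z \<in> W" "z \<notin> X" for z
          using that W(2) X(3) by auto
        have "?f a \<in> {u, v} - X" "?f b \<in> {u, v} - X" using f ab eG by blast+
        moreover have "conn (ends ?K) (avoiding ?K X) u v" if "u \<notin> X" "v \<notin> X"
          by (rule conn_edge[of n]) (use that n in \<open>auto simp: avoiding_def\<close>)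
        ultimately show ?thesis by (auto intro: conn_sym simp del: if_split)
      qed
    qed
    then show ?thesis using X by simp
  qed
  have "connected_graph ?K"
    using proj[of "{}"] G(2) uv HG(1) unfolding non_separable_def connected_graph_conn n(3)
    by (auto simp: subset_iff)
  moreover have "conn (ends ?K) (avoiding ?K {w}) x y"
    if "x \<in> verts H - {w}" "y \<in> verts H - {w}" for w x y
    using that HG(1) uv(3) by (intro proj non_separable_conn[OF G]) auto
  moreover have "\<not> is_loop ?K e" if "e \<in> edges ?K" for e
    using that n nl uv(3) by (cases "e = n") (auto simp: is_loop_def)
  ultimately show ?thesis
    using wf_graph_add_edge[OF wfH uv(1,2)] n(3) by (simp add: non_separable_iff)
qed

section \<open>Invariance under isomorphism\<close>

lemma inj_on_image_subset:
  assumes "inj_on f C" "A \<subseteq> C" "B \<subseteq> C"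
  shows "f ` A \<subseteq> f ` B \<longleftrightarrow> A \<subseteq> B"
proof
  assume AB: "f ` A \<subseteq> f ` B"
  show "A \<subseteq> B"
  proof
    fix x assume x: "x \<in> A"
    then obtain y where y: "y \<in> B" "f x = f y" using AB by blast
    then have "x = y" using x assms by (intro inj_onD[OF assms(1)]) auto
    then show "x \<in> B" using y by simp
  qed
qed (rule image_mono)

text \<open>The end map is that of the target graph, since \<open>subgraph\<close> demands the same
  end map as the host.\<close>

definition image_graph :: "'v graph \<Rightarrow> ('v \<Rightarrow> 'v) \<Rightarrow> (nat \<Rightarrow> nat) \<Rightarrow> 'v graph \<Rightarrow> 'v graph" where
  "image_graph G f k B = \<lparr>verts = f ` verts B, edges = k ` edges B, ends = ends G\<rparr>"

text \<open>Taking images is an isomorphism between the subgraph orders of \<open>H\<close> and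
  \<open>G\<close> that preserves non-separability, so it matches the maximal non-separable
  subgraphs.\<close>

lemma graph_iso_nblocks:
  assumes wf: "wf_graph (H :: 'v graph)" "wf_graph (G :: 'v graph)"
    and f: "bij_betw f (verts H) (verts G)" and k: "bij_betw k (edges H) (edges G)"
    and fk: "\<And>e. e \<in> edges H \<Longrightarrow> ends G (k e) = map_uprod f (ends H e)"
  shows "nblocks H = nblocks G"
proof -
  let ?I = "image_graph G f k"
  have inj: "inj_on f (verts H)" "inj_on k (edges H)" using f k by (auto simp: bij_betw_def)
  have im: "f ` verts H = verts G" "k ` edges H = edges G" using f k by (auto simp: bij_betw_def)
  have wfI: "wf_graph (?I B)" if B: "subgraph B H" for B
  proof -
    have B': "wf_graph B" "edges B \<subseteq> edges H" "ends B = ends H" using B by (auto simp: subgraph_def)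
    have "set_uprod (ends G (k e)) \<subseteq> f ` verts B" if e: "e \<in> edges B" for e
    proof -
      have "e \<in> edges H" using e B'(2) by blast
      then show ?thesis
        using fk wf_graph_ends_subset[OF B'(1) e] B'(3) by (simp add: uprod.set_map image_mono)
    qed
    then show ?thesis using B'(1) by (simp add: image_graph_def wf_graph_def)
  qed
  have sub_iff: "subgraph (?I A) (?I B) \<longleftrightarrow> subgraph A B" if "subgraph A H" "subgraph B H" for A B
  proof -
    have "f ` verts A \<subseteq> f ` verts B \<longleftrightarrow> verts A \<subseteq> verts B" "k ` edges A \<subseteq> k ` edges B \<longleftrightarrow> edges A \<subseteq> edges B"
      using that by (simp_all add: subgraph_def inj_on_image_subset[OF inj(1)] inj_on_image_subset[OF inj(2)])
    then show ?thesis
      using wfI[OF that(1)] that by (simp add: subgraph_def image_graph_def)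
  qed
  have subG: "subgraph (?I B) G" if "subgraph B H" for B
    using wfI[OF that] that by (simp add: subgraph_def image_graph_def image_mono flip: im)
  \<comment> \<open>The preimage consists of all vertices and edges of \<open>H\<close> mapped into
    \<open>C\<close>.\<close>
  have surj: "\<exists>B. subgraph B H \<and> ?I B = C" if C: "subgraph C G" for C
  proof -
    let ?B = "\<lparr>verts = {x\<in>verts H. f x \<in> verts C}, edges = {e\<in>edges H. k e \<in> edges C}, ends = ends H\<rparr>"
    have C': "wf_graph C" "verts C \<subseteq> verts G" "edges C \<subseteq> edges G" "ends C = ends G"
      using C by (auto simp: subgraph_def)
    have "x \<in> verts H \<and> f x \<in> verts C" if e: "e \<in> edges H" "k e \<in> edges C" "x \<in> set_uprod (ends H e)" for e x
    proof -
      have "f x \<in> set_uprod (ends G (k e))" using fk[OF e(1)] e(3) by (simp add: uprod.set_map)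
      then show ?thesis
        using wf_graph_ends_subset[OF C'(1) e(2)] C'(4) wf_graph_ends_subset[OF wf(1) e(1)] e(3) by auto
    qed
    then have "wf_graph ?B" using wf(1) by (auto simp: wf_graph_def)
    then have "subgraph ?B H" by (auto simp: subgraph_def)
    moreover have "f ` {x\<in>verts H. f x \<in> verts C} = verts C" "k ` {e\<in>edges H. k e \<in> edges C} = edges C"
      using C'(2,3) unfolding im[symmetric] by blast+
    then have "?I ?B = C" using C'(4) by (simp add: image_graph_def)
    ultimately show ?thesis by blast
  qed
  have conn_iff: "conn (ends G) (k ` A) (f a) (f b) \<longleftrightarrow> conn (ends H) A a b"
    if "A \<subseteq> edges H" "a \<in> verts H" "b \<in> verts H" for A a b
  proof -
    have "finite A" using that(1) wf(1) by (auto simp: wf_graph_def intro: finite_subset)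
    from nul_image[OF this inj_on_subset[OF inj(2) that(1)] inj(1), of "ends G" "ends H"]
    show ?thesis using that fk wf_graph_ends_subset[OF wf(1)] by blast
  qed
  have ns: "non_separable (?I B) \<longleftrightarrow> non_separable B" if B: "subgraph B H" for B
  proof -
    have B': "wf_graph B" "verts B \<subseteq> verts H" "edges B \<subseteq> edges H" "ends B = ends H"
      using B by (auto simp: subgraph_def)
    have av: "avoiding (?I B) {f w} = k ` avoiding B {w}" if w: "w \<in> verts H" for w
    proof -
      have "f w \<in> set_uprod (ends G (k e)) \<longleftrightarrow> w \<in> set_uprod (ends H e)" if "e \<in> edges B" for e
      proof -
        have "e \<in> edges H" using that B' by blast
        then show ?thesis
          using fk wf_graph_ends_subset[OF wf(1)] w inj(1) by (simp add: uprod.set_map inj_on_image_mem_iff)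
      qed
      then show ?thesis using B'(4) by (auto simp: avoiding_def image_graph_def)
    qed
    have "connected_graph (?I B) \<longleftrightarrow> connected_graph B"
      using conn_iff[OF B'(3)] B'(2,4) unfolding connected_graph_conn
      by (simp add: image_graph_def subset_iff)
    moreover have "(\<forall>v\<in>verts (?I B). \<forall>x\<in>verts (?I B) - {v}. \<forall>y\<in>verts (?I B) - {v}.
          conn (ends (?I B)) (avoiding (?I B) {v}) x y) \<longleftrightarrow>
        (\<forall>v\<in>verts B. \<forall>x\<in>verts B - {v}. \<forall>y\<in>verts B - {v}. conn (ends B) (avoiding B {v}) x y)"
    proof -
      have "verts (?I B) - {f v} = f ` (verts B - {v})" if "v \<in> verts B" for v
        using that inj_on_subset[OF inj(1) B'(2)] by (auto simp: image_graph_def inj_on_def)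
      moreover have "conn (ends G) (k ` avoiding B {v}) (f x) (f y) \<longleftrightarrow> conn (ends H) (avoiding B {v}) x y"
        if "x \<in> verts B" "y \<in> verts B" for v x y
        using that B' by (intro conn_iff) (auto simp: avoiding_def)
      moreover have "verts (?I B) = f ` verts B" "ends (?I B) = ends G" by (simp_all add: image_graph_def)
      ultimately show ?thesis using av B'(2,4) by (simp add: subset_iff)
    qed
    moreover have "is_loop (?I B) (k e) \<longleftrightarrow> is_loop B e" if "e \<in> edges B" for e
    proof -
      obtain a b where ab: "ends H e = Upair a b" by (metis uprod_exhaust)
      moreover have "e \<in> edges H" using that B' by blast
      ultimately have "a \<in> verts H" "b \<in> verts H" "ends G (k e) = Upair (f a) (f b)"
        using fk wf_graph_endsD[OF wf(1), of e a b] by simp_all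
      then show ?thesis
        using ab inj(1) B'(4) by (auto simp: is_loop_def image_graph_def dest: inj_onD)
    qed
    moreover have "card (verts (?I B)) = card (verts B)" "card (edges (?I B)) = card (edges B)"
      using inj_on_subset[OF inj(1) B'(2)] inj_on_subset[OF inj(2) B'(3)]
      by (simp_all add: image_graph_def card_image)
    moreover have "edges (?I B) = k ` edges B" by (simp add: image_graph_def)
    ultimately show ?thesis
      unfolding non_separable_iff[OF wfI[OF B]] non_separable_iff[OF B'(1)] by simp
  qed
  have I_inj: "A = B" if "subgraph A H" "subgraph B H" "?I A = ?I B" for A B
  proof -
    have "subgraph (?I A) (?I B)" "subgraph (?I B) (?I A)"
      using that subgraph_refl[OF wfI] by metis+
    then have "subgraph A B" "subgraph B A" using sub_iff that by blast+
    then show ?thesis by (intro graph_eqI) (auto simp: subgraph_def)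
  qed
  have block: "is_block G (?I B) \<longleftrightarrow> is_block H B" if B: "subgraph B H" for B
  proof
    assume "is_block G (?I B)"
    then show "is_block H B"
      unfolding is_block_def using B ns sub_iff subG I_inj by meson
  next
    assume "is_block H B"
    then have *: "non_separable B" "\<And>A. subgraph A H \<Longrightarrow> non_separable A \<Longrightarrow> subgraph B A \<Longrightarrow> A = B"
      by (simp_all add: is_block_def)
    have "C = ?I B" if C: "subgraph C G" "non_separable C" "subgraph (?I B) C" for C
    proof -
      obtain A where A: "subgraph A H" "?I A = C" using surj[OF C(1)] by blast
      then have "non_separable A" "subgraph B A" using C ns[OF A(1)] sub_iff[OF B A(1)] by auto
      then show ?thesis using *(2) A by blast
    qed
    then show "is_block G (?I B)"
      unfolding is_block_def using subG[OF B] ns[OF B] *(1) by blast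
  qed
  have "bij_betw ?I {B. is_block H B \<and> edges B \<noteq> {}} {B. is_block G B \<and> edges B \<noteq> {}}"
  proof (rule bij_betw_imageI)
    show "inj_on ?I {B. is_block H B \<and> edges B \<noteq> {}}"
      using I_inj by (auto intro!: inj_onI dest: is_block_subgraph)
    have e: "edges (?I B) = {} \<longleftrightarrow> edges B = {}" for B by (simp add: image_graph_def)
    show "?I ` {B. is_block H B \<and> edges B \<noteq> {}} = {B. is_block G B \<and> edges B \<noteq> {}}"
    proof (intro equalityI subsetI)
      fix C assume "C \<in> ?I ` {B. is_block H B \<and> edges B \<noteq> {}}"
      then obtain B where "C = ?I B" "is_block H B" "edges B \<noteq> {}" by blast
      then show "C \<in> {B. is_block G B \<and> edges B \<noteq> {}}"
        using block[OF is_block_subgraph] e by simp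
    next
      fix C assume C: "C \<in> {B. is_block G B \<and> edges B \<noteq> {}}"
      then obtain B where "subgraph B H" "?I B = C" using surj is_block_subgraph by blast
      then have "is_block H B \<and> edges B \<noteq> {}" using C block e by auto
      then show "C \<in> ?I ` {B. is_block H B \<and> edges B \<noteq> {}}" using \<open>?I B = C\<close> by blast
    qed
  qed
  then show ?thesis unfolding nblocks_def by (rule bij_betw_same_card)
qed

lemma graph_iso_invariants:
  assumes "wf_graph H" "wf_graph G" "graph_iso H G"
  shows "card (verts H) = card (verts G)" "card (edges H) = card (edges G)" "Qf H x = Qf G x"
proof -
  obtain f k where f: "bij_betw f (verts H) (verts G)" and k: "bij_betw k (edges H) (edges G)"
    and fk: "\<And>e. e \<in> edges H \<Longrightarrow> ends G (k e) = map_uprod f (ends H e)"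
    using assms(3) unfolding graph_iso_def by blast
  show cv: "card (verts H) = card (verts G)" and ce: "card (edges H) = card (edges G)"
    using f k by (auto dest: bij_betw_same_card)
  have "fsum (ends G) (k ` edges H) = fsum (ends H) (edges H)"
  proof (rule fsum_image)
    show "inj_on f (verts H)" "inj_on k (edges H)" using f k by (auto simp: bij_betw_def)
    show "finite (edges H)" using assms(1) by (simp add: wf_graph_def)
  qed (use fk wf_graph_ends_subset[OF assms(1)] in auto)
  then have "fsum (ends G) (edges G) = fsum (ends H) (edges H)" using k by (simp add: bij_betw_def)
  then show "Qf H x = Qf G x"
    using cv ce graph_iso_nblocks[OF assms(1,2) f k fk] by (simp add: Qf_eq assms(1,2))
qed


section \<open>Sign computations and the reductions (a)--(d)\<close>

definition qsign :: "'v graph \<Rightarrow> real" where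
  "qsign G = (if even (card (edges G) + card (verts G) + nblocks G) then - 1 else 1)"

lemma Qf_qsign: "wf_graph G \<Longrightarrow> Qf G x = qsign G * poly (fsum (ends G) (edges G)) x"
  by (simp add: Qf_eq qsign_def)

text \<open>Each sign is -1 to the power |E| + |V| + b + 1, so the claim compares the parity of two
  such exponents with a third.\<close>

lemma qsign_mult:
  assumes "odd ((card (edges G) + card (verts G) + nblocks G)
    + (card (edges H) + card (verts H) + nblocks H) + (card (edges K) + card (verts K) + nblocks K))"
  shows "qsign H * qsign K = qsign G"
  using assms by (auto simp: qsign_def)

lemma qsign_mult_minus:
  assumes "even ((card (edges G) + card (verts G) + nblocks G)
    + (card (edges H) + card (verts H) + nblocks H) + (card (edges K) + card (verts K) + nblocks K))"
  shows "qsign H * qsign K = - qsign G"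
  using assms by (auto simp: qsign_def)

lemma bridgeless_delete_edge_connected:
  assumes "wf_graph G" "connected_graph G" "bridgeless G"
  shows "connected_graph (delete_edge G e)"
proof (cases "e \<in> edges G")
  case True
  obtain a b where ab: "ends G e = Upair a b" by (metis uprod_exhaust)
  have "conn (ends G) (edges G - {e}) a b"
    using assms(3) True ab by (auto simp: bridgeless_def is_bridge_def reach_conn delete_edge_def)
  then have "conn (ends G) (edges G - {e}) x y" if "conn (ends G) (insert e (edges G - {e})) x y" for x y
    using that via_imp_conn conn_insert[of "ends G" e a b, OF ab] by metis
  then show ?thesis
    using assms(2) True by (simp add: connected_graph_conn delete_edge_def insert_absorb)
next
  case False
  then show ?thesis using assms(2) by (simp add: delete_edge_def)
qed

text \<open>Deleting an end \<open>v\<close> of \<open>e\<close> removes \<open>e\<close> as well,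
  so \<open>G - e - v\<close> is \<open>G - v\<close>. In (a) this keeps the cut-vertex off
  \<open>e\<close>, so the added edges are not loops.\<close>

lemma cut_vertex_delete_edge_end:
  assumes "wf_graph G" "connected_graph G" "bridgeless G"
    and "cut_vertex (delete_edge G e) v" "v \<in> set_uprod (ends G e)"
  shows "cut_vertex G v"
proof -
  have "avoiding (delete_edge G e) {v} = avoiding G {v}"
    using assms(5) by (auto simp: avoiding_def delete_edge_def)
  moreover have "verts (delete_edge G e) = verts G" "ends (delete_edge G e) = ends G"
    by (simp_all add: delete_edge_def)
  ultimately show ?thesis
    using assms(4) cut_vertex_iff[OF assms(1,2)]
      cut_vertex_iff[OF wf_graph_delete_edge[OF assms(1)] bridgeless_delete_edge_connected[OF assms(1-3)]]
    by simp
qed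

lemma non_separable_loopless:
  assumes "non_separable G" "u \<in> verts G" "v \<in> verts G" "u \<noteq> v" "e \<in> edges G"
  shows "\<not> is_loop G e"
proof -
  have "card (verts G) \<noteq> 1" using assms(2-4) by (auto simp: card_1_singleton_iff)
  then show ?thesis using assms(1,5) by (auto simp: non_separable_def)
qed

lemma nblocks_add_edge:
  assumes "wf_graph H" "u \<in> verts H" "v \<in> verts H" "non_separable (add_edge H u v)"
  shows "nblocks (add_edge H u v) = 1"
proof (rule nblocks_non_separable[OF wf_graph_add_edge[OF assms(1-3)] assms(4)])
  have "card (edges (add_edge H u v)) \<noteq> 0"
    using assms(1) by (simp add: card_edges_add_edge wf_graph_def)
  then show "edges (add_edge H u v) \<noteq> {}" by auto
qed

lemma one_sum_edge_non_separable:
  assumes G: "wf_graph G" "non_separable G" and os: "one_sum (delete_edge G e) v H K"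
    and e: "ends G e = Upair a b" "a \<in> verts H" "b \<in> verts K" "a \<noteq> v"
  shows "non_separable (add_edge H v a)"
proof -
  have HG: "subgraph H G" "verts H \<union> verts K = verts G" "edges H \<union> edges K = edges G - {e}"
    and HK: "verts H \<inter> verts K = {v}" and K: "wf_graph K" "ends K = ends G"
    using os by (auto simp: one_sum_def subgraph_def delete_edge_def)
  have vH: "v \<in> verts H" "v \<in> verts G" "a \<in> verts G" using HK HG(2) e by auto
  \<comment> \<open>The part of \<open>G\<close> outside \<open>H\<close> is \<open>K\<close>
    together with \<open>e\<close>, so it meets \<open>H\<close> only in \<open>v\<close> and in the
    end \<open>a\<close> of \<open>e\<close>.\<close>
  show ?thesis
  proof (rule non_separable_add_edge[OF G HG(1) vH(1) e(2) e(4)[symmetric], where W = "insert a (verts K)"])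
    show "set_uprod (ends G d) \<subseteq> insert a (verts K)" if "d \<in> edges G - edges H" for d
    proof (cases "d = e")
      case True
      then show ?thesis using e by simp
    next
      case False
      then have "d \<in> edges K" using that HG(3) by blast
      then show ?thesis using wf_graph_ends_subset[OF K(1)] K(2) by auto
    qed
    show "verts H \<inter> insert a (verts K) \<subseteq> {v, a}" using HK by auto
    show "\<not> is_loop G d" if "d \<in> edges H" for d
      by (rule non_separable_loopless[OF G(2) vH(2,3) e(4)[symmetric]]) (use that HG(1) in \<open>auto simp: subgraph_def\<close>)
  qed
qed

text \<open>Reduction (a). F(G) is \<lambda> - 1 times the sum over edge sets of
  \<open>G - e\<close> connecting \<open>a\<close> and \<open>b\<close>. These must pass through
  \<open>v\<close>, so the sum factors, and one more \<lambda> - 1 turns both factors into flow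
  polynomials.\<close>

lemma Qf_one_sum_edge:
  assumes G: "wf_graph G" "non_separable G" and os: "one_sum (delete_edge G e) v H K"
    and e: "e \<in> edges G" "ends G e = Upair a b" "a \<in> verts H" "b \<in> verts K" "a \<noteq> v" "b \<noteq> v"
  shows "(x - 1) * Qf G x = Qf (add_edge H v a) x * Qf (add_edge K v b) x"
proof -
  have wf: "wf_graph H" "wf_graph K" and en: "ends H = ends G" "ends K = ends G"
    and E: "edges H \<union> edges K = edges G - {e}" "edges H \<inter> edges K = {}"
    and V: "verts H \<inter> verts K = {v}" "verts H \<union> verts K = verts G"
    using os by (auto simp: one_sum_def subgraph_def delete_edge_def)
  have v: "v \<in> verts H" "v \<in> verts K" using V by auto
  have fin: "finite (edges H)" "finite (edges K)" "finite (verts H)" "finite (verts K)" "finite (edges G)"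
    using wf G(1) by (auto simp: wf_graph_def)
  have EG: "edges G = insert e (edges H \<union> edges K)" using E(1) e(1) by auto
  have eHK: "e \<notin> edges H \<union> edges K" using E(1) by auto
  have nH: "nblocks (add_edge H v a) = 1"
    using nblocks_add_edge[OF wf(1) v(1) e(3)] one_sum_edge_non_separable[OF G os e(2-5)] by blast
  have nK: "nblocks (add_edge K v b) = 1"
  proof (rule nblocks_add_edge[OF wf(2) v(2) e(4)])
    have "ends G e = Upair b a" using e(2) by simp
    then show "non_separable (add_edge K v b)"
      using one_sum_edge_non_separable[OF G one_sum_commute[OF os]] e by blast
  qed
  have nG: "nblocks G = 1" using nblocks_non_separable[OF G] e(1) by blast
  have cE: "card (edges G) = card (edges H) + card (edges K) + 1"
    using EG eHK card_Un_disjoint[OF fin(1,2) E(2)] fin by simp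
  have cV: "card (verts G) + 1 = card (verts H) + card (verts K)"
    using card_Un_Int[OF fin(3,4)] V by simp
  have sgn: "qsign (add_edge H v a) * qsign (add_edge K v b) = qsign G"
    by (rule qsign_mult) (simp add: nH nK nG card_edges_add_edge fin cE, use cV in presburger)
  have "fsum (ends G) (edges G) = [:-1, 1:] * csum (ends G) (edges H \<union> edges K) a b"
    unfolding EG by (rule fsum_insert) (use fin eHK e in auto)
  also have "csum (ends G) (edges H \<union> edges K) a b
      = csum (ends G) (edges H) v a * csum (ends G) (edges K) v b"
    by (rule fsum_glue_one(2)[where V = "verts H" and W = "verts K"])
      (use fin E V v e wf_graph_ends_subset[OF wf(1)] wf_graph_ends_subset[OF wf(2)] en in auto)
  finally have F: "fsum (ends G) (edges G)
      = [:-1, 1:] * (csum (ends G) (edges H) v a * csum (ends G) (edges K) v b)" .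
  have prod: "Qf (add_edge H v a) x * Qf (add_edge K v b) x = qsign G *
      ((x - 1) * poly (csum (ends G) (edges H) v a) x * ((x - 1) * poly (csum (ends G) (edges K) v b) x))"
    using wf v e(3,4) fin
    by (simp add: Qf_qsign wf_graph_add_edge fsum_add_edge en algebra_simps flip: sgn)
  show ?thesis
    unfolding prod Qf_qsign[OF G(1)] F by (simp add: algebra_simps)
qed

section \<open>Graphs glued at two vertices\<close>

definition two_sum :: "'v graph \<Rightarrow> 'v \<Rightarrow> 'v \<Rightarrow> 'v graph \<Rightarrow> 'v graph \<Rightarrow> bool" where
  "two_sum G u v H K \<longleftrightarrow> subgraph H G \<and> subgraph K G \<and> edges H \<inter> edges K = {} \<and>
     edges H \<union> edges K = edges G \<and> verts H \<inter> verts K = {u, v} \<and> verts H \<union> verts K = verts G"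

lemma two_sum_commute: "two_sum G u v H K \<Longrightarrow> two_sum G u v K H"
  by (auto simp: two_sum_def)

text \<open>Otherwise \<open>G\<close> would be a one-vertex gluing of two parts with edges.\<close>

lemma two_sum_distinct:
  assumes "wf_graph G" "non_separable G" "two_sum G u v H K" "edges H \<noteq> {}" "edges K \<noteq> {}"
  shows "u \<noteq> v"
proof
  assume "u = v"
  note ts = assms(3)[unfolded two_sum_def subgraph_def]
  have "edges H = {} \<or> edges K = {}"
  proof (rule non_separable_one_side[OF assms(1,2)])
    show "edges G = edges H \<union> edges K" "edges H \<inter> edges K = {}" using ts by simp_all
    show "verts H \<inter> verts K \<subseteq> {v}" using ts \<open>u = v\<close> by simp
    show "set_uprod (ends G e) \<subseteq> verts H" if "e \<in> edges H" for e
      using ts wf_graph_ends_subset[of H e] that by simp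
    show "set_uprod (ends G e) \<subseteq> verts K" if "e \<in> edges K" for e
      using ts wf_graph_ends_subset[of K e] that by simp
  qed
  then show False using assms(4,5) by simp
qed

lemma two_sum_non_separable:
  assumes "wf_graph G" "non_separable G" "two_sum G u v H K" "u \<noteq> v"
  shows "non_separable (add_edge H u v)"
proof -
  note ts = assms(3)[unfolded two_sum_def]
  have uv: "u \<in> verts H" "v \<in> verts H" "u \<in> verts G" "v \<in> verts G" using ts by auto
  show ?thesis
  proof (rule non_separable_add_edge[OF assms(1,2) _ uv(1,2) assms(4), where W = "verts K"])
    show "subgraph H G" "verts H \<inter> verts K \<subseteq> {u, v}" using ts by simp_all
    show "set_uprod (ends G e) \<subseteq> verts K" if "e \<in> edges G - edges H" for e
    proof -
      have "e \<in> edges K" "wf_graph K" "ends K = ends G" using ts that by (auto simp: subgraph_def)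
      then show ?thesis using wf_graph_ends_subset[of K e] by simp
    qed
    show "\<not> is_loop G e" if "e \<in> edges H" for e
      by (rule non_separable_loopless[OF assms(2) uv(3,4) assms(4)]) (use that ts in auto)
  qed
qed

lemma non_separable_add_edge_self:
  assumes "wf_graph G" "non_separable G" "u \<in> verts G" "v \<in> verts G" "u \<noteq> v"
  shows "non_separable (add_edge G u v)"
  by (rule non_separable_add_edge[OF assms(1,2) subgraph_refl[OF assms(1)] assms(3-5), where W = "{}"])
    (use non_separable_loopless[OF assms(2-5)] in auto)

lemma two_sum_card:
  assumes "wf_graph G" "two_sum G u v H K" "u \<noteq> v"
  shows "card (edges G) = card (edges H) + card (edges K)"
    and "card (verts G) + 2 = card (verts H) + card (verts K)"
proof -
  note ts = assms(2)[unfolded two_sum_def subgraph_def]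
  have fin: "finite (edges H)" "finite (edges K)" "finite (verts H)" "finite (verts K)"
    using ts by (auto simp: wf_graph_def)
  show "card (edges G) = card (edges H) + card (edges K)"
    using card_Un_disjoint[OF fin(1,2)] ts by simp
  show "card (verts G) + 2 = card (verts H) + card (verts K)"
    using card_Un_Int[OF fin(3,4)] ts assms(3) by simp
qed

lemma two_sum_fsum:
  assumes "wf_graph G" "two_sum G u v H K" "u \<noteq> v"
  shows "fsum (ends G) (edges G) = fsum (ends H) (edges H) * fsum (ends K) (edges K)
    + [:-1, 1:] * (csum (ends H) (edges H) u v * csum (ends K) (edges K) u v)"
proof -
  note ts = assms(2)[unfolded two_sum_def subgraph_def]
  have "fsum (ends G) (edges H \<union> edges K) = fsum (ends G) (edges H) * fsum (ends G) (edges K)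
    + [:-1, 1:] * (csum (ends G) (edges H) u v * csum (ends G) (edges K) u v)"
  proof (rule fsum_glue_two)
    show "finite (edges H)" "finite (edges K)" using ts by (auto simp: wf_graph_def)
    show "set_uprod (ends G e) \<subseteq> verts H" if "e \<in> edges H" for e
      using ts wf_graph_ends_subset[of H e] that by simp
    show "set_uprod (ends G e) \<subseteq> verts K" if "e \<in> edges K" for e
      using ts wf_graph_ends_subset[of K e] that by simp
  qed (use ts assms(3) in auto)
  then show ?thesis using ts by simp
qed

text \<open>Reduction (c). The two graphs with an added edge have one block each, two in total, so
  the signs of both products agree if the blocks of \<open>H\<close> and \<open>K\<close> are even
  in number as well.\<close>

lemma Qf_two_sum:
  assumes G: "wf_graph G" "non_separable G" and ts: "two_sum G u v H K"
    and ne: "edges H \<noteq> {}" "edges K \<noteq> {}" and par: "even (nblocks H + nblocks K)"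
  shows "(x - 1) * Qf G x = (x - 1) * (Qf H x * Qf K x)
    + Qf (add_edge H u v) x * Qf (add_edge K u v) x"
proof -
  note uv = two_sum_distinct[OF G ts ne]
  have wf: "wf_graph H" "wf_graph K"
    and V: "u \<in> verts H" "v \<in> verts H" "u \<in> verts K" "v \<in> verts K" and EG: "edges G \<noteq> {}"
    using ts ne by (auto simp: two_sum_def subgraph_def)
  have fin: "finite (edges H)" "finite (edges K)" using wf by (auto simp: wf_graph_def)
  note c = two_sum_card[OF G(1) ts uv]
  have n: "nblocks G = 1" "nblocks (add_edge H u v) = 1" "nblocks (add_edge K u v) = 1"
    using nblocks_non_separable[OF G EG] nblocks_add_edge[OF wf(1) V(1,2)] nblocks_add_edge[OF wf(2) V(3,4)]
      two_sum_non_separable[OF G ts uv] two_sum_non_separable[OF G two_sum_commute[OF ts] uv] by blast+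
  have s1: "qsign H * qsign K = qsign G"
    by (rule qsign_mult) (use c par n(1) in presburger)
  have s2: "qsign (add_edge H u v) * qsign (add_edge K u v) = qsign G"
    by (rule qsign_mult) (simp add: n card_edges_add_edge fin, use c in presburger)
  have 1: "Qf H x * Qf K x = qsign G *
      (poly (fsum (ends H) (edges H)) x * poly (fsum (ends K) (edges K)) x)"
    using wf by (simp add: Qf_qsign flip: s1)
  have 2: "Qf (add_edge H u v) x * Qf (add_edge K u v) x = qsign G *
      ((x - 1) * poly (csum (ends H) (edges H) u v) x * ((x - 1) * poly (csum (ends K) (edges K) u v) x))"
    using wf V fin by (simp add: Qf_qsign wf_graph_add_edge fsum_add_edge algebra_simps flip: s2)
  show ?thesis
    unfolding 1 2 Qf_qsign[OF G(1)] two_sum_fsum[OF G(1) ts uv] by (simp add: algebra_simps)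
qed

lemma identify_simps:
  assumes "u \<in> verts G" "v \<in> verts G" "u \<noteq> v"
  shows "edges (identify G u v) = edges G" "verts (identify G u v) = verts G - {v}"
    "ends (identify G u v) = (\<lambda>e. map_uprod (\<lambda>x. if x = v then u else x) (ends G e))"
  using assms by (auto simp: identify_def Let_def)

lemma card_verts_identify:
  assumes "wf_graph G" "u \<in> verts G" "v \<in> verts G" "u \<noteq> v"
  shows "card (verts G) = card (verts (identify G u v)) + 1"
  using assms card_Suc_Diff1[of "verts G" v] by (simp add: identify_simps wf_graph_def)

text \<open>Reduction (d). F(H) is eliminated through F(H/uv) = F(H) + (\<lambda> - 1) P(H). The
  correction -(\<lambda> - 1) P(H) F(K) is supplied by K + 2uv, whose flow polynomial is (\<lambda>
  - 1)(F(K) + (\<lambda> - 2) P(K)), and the terms P(H) P(K) balance because (\<lambda> - 1) -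
  (\<lambda> - 2) = 1.\<close>

lemma Qf_two_sum_identify:
  assumes G: "wf_graph G" "non_separable G" and ts: "two_sum G u v H K"
    and ne: "edges H \<noteq> {}" "edges K \<noteq> {}" and par: "odd (nblocks (identify H u v) + nblocks K)"
  shows "(x - 1) * Qf G x = (x - 1) * (Qf (identify H u v) x * Qf K x)
    + (x - 1) * (Qf (add_edge H u v) x * Qf (add_edge K u v) x)
    + Qf (add_edge H u v) x * Qf (add_edge (add_edge K u v) u v) x"
proof -
  note uv = two_sum_distinct[OF G ts ne]
  have wf: "wf_graph H" "wf_graph K"
    and V: "u \<in> verts H" "v \<in> verts H" "u \<in> verts K" "v \<in> verts K" and EG: "edges G \<noteq> {}"
    using ts ne by (auto simp: two_sum_def subgraph_def)
  let ?I = "identify H u v" and ?H1 = "add_edge H u v"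
    and ?K1 = "add_edge K u v" and ?K2 = "add_edge (add_edge K u v) u v"
  have wf': "wf_graph ?I" "wf_graph ?H1" "wf_graph ?K1" "wf_graph ?K2"
    using wf V by (simp_all add: wf_graph_identify wf_graph_add_edge)
  have fin: "finite (edges H)" "finite (edges K)" "finite (edges ?K1)"
    using wf wf' by (auto simp: wf_graph_def)
  note c = two_sum_card[OF G(1) ts uv] card_verts_identify[OF wf(1) V(1,2) uv]
  have nsK: "non_separable ?K1" by (rule two_sum_non_separable[OF G two_sum_commute[OF ts] uv])
  have n: "nblocks G = 1" "nblocks ?H1 = 1" "nblocks ?K1 = 1" "nblocks ?K2 = 1"
    using nblocks_non_separable[OF G EG] nblocks_add_edge[OF wf(1) V(1,2)] nblocks_add_edge[OF wf(2) V(3,4)]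
      two_sum_non_separable[OF G ts uv] nsK nblocks_add_edge[OF wf'(3)]
      non_separable_add_edge_self[OF wf'(3) nsK _ _ uv] V by simp_all
  have s1: "qsign ?I * qsign K = qsign G"
    by (rule qsign_mult) (use c par n(1) identify_simps(1)[OF V(1,2) uv] in presburger)
  have s2: "qsign ?H1 * qsign ?K1 = qsign G"
    by (rule qsign_mult) (simp add: n card_edges_add_edge fin, use c in presburger)
  \<comment> \<open>\<open>K + 2uv\<close> has one edge more than \<open>K + uv\<close> and also one
    block, so its sign is opposite. This absorbs the minus sign of its term.\<close>
  have s3: "qsign ?H1 * qsign ?K2 = - qsign G"
    by (rule qsign_mult_minus) (simp add: n card_edges_add_edge fin, use c in presburger)
  let ?f = "poly (fsum (ends H) (edges H)) x" and ?c = "poly (csum (ends H) (edges H) u v) x"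
    and ?g = "poly (fsum (ends K) (edges K)) x" and ?d = "poly (csum (ends K) (edges K) u v) x"
  have FI: "fsum (ends ?I) (edges ?I) = fsum (ends H) (edges H) + [:-1, 1:] * csum (ends H) (edges H) u v"
    using fsum_identify[OF fin(1) uv] by (simp only: identify_simps[OF V(1,2) uv])
  have 1: "Qf ?I x * Qf K x = qsign G * ((?f + (x - 1) * ?c) * ?g)"
    using wf wf' by (simp add: Qf_qsign FI algebra_simps flip: s1)
  have 2: "Qf ?H1 x * Qf ?K1 x = qsign G * ((x - 1) * ?c * ((x - 1) * ?d))"
    using wf' fin by (simp add: Qf_qsign fsum_add_edge algebra_simps flip: s2)
  have "Qf ?H1 x * Qf ?K2 x = (qsign ?H1 * qsign ?K2)
      * ((x - 1) * ?c * ((x - 1) * (?g + (x - 2) * ?d)))"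
    using wf' fin by (simp add: Qf_qsign fsum_add_edge algebra_simps)
  then have 3: "Qf ?H1 x * Qf ?K2 x
      = - qsign G * ((x - 1) * ?c * ((x - 1) * (?g + (x - 2) * ?d)))"
    by (simp only: s3)
  show ?thesis
    unfolding 1 2 3 Qf_qsign[OF G(1)] two_sum_fsum[OF G(1) ts uv] by (simp add: algebra_simps)
qed

text \<open>Reduction (b). With odd block numbers, contraction loses an edge and a vertex and keeps
  the sign; deletion loses just an edge and flips it, which cancels the minus sign of the
  recurrence.\<close>

lemma Qf_delete_contract:
  assumes G: "wf_graph G" "non_separable G" "bridgeless G" and e: "e \<in> edges G"
    and par: "odd (nblocks (delete_edge G e))" "odd (nblocks (contract G e))"
  shows "Qf G x = Qf (contract G e) x + Qf (delete_edge G e) x"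
    and "card (verts (contract G e)) + 1 = card (verts G)"
    and "card (edges (contract G e)) + 1 = card (edges G)"
    and "wf_graph (contract G e)"
proof -
  \<comment> \<open>A loop would be the only edge, and its deletion would leave 0 blocks, an even
    number.\<close>
  have nl: "\<not> is_loop G e"
  proof
    assume "is_loop G e"
    then have "card (edges G) = 1" using G(2) e by (auto simp: non_separable_def)
    then have "edges G = {e}" using e by (auto simp: card_1_singleton_iff)
    then have "edges (delete_edge G e) = {}" by (simp add: delete_edge_def)
    then show False using par(1) nblocks_edgeless by fastforce
  qed
  obtain a b where ab: "ends G e = Upair a b" "contract G e = identify (delete_edge G e) a b"
    by (rule contract_eq)
  have D: "edges (delete_edge G e) = edges G - {e}" "verts (delete_edge G e) = verts G"
    by (simp_all add: delete_edge_def)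
  have ab': "a \<noteq> b" "a \<in> verts (delete_edge G e)" "b \<in> verts (delete_edge G e)"
    using nl ab(1) wf_graph_endsD[OF G(1) e ab(1)] D(2) by (auto simp: is_loop_def)
  note wfD = wf_graph_delete_edge[OF G(1), of e]
  show wfC: "wf_graph (contract G e)" unfolding ab(2) by (rule wf_graph_identify[OF wfD])
  show cv: "card (verts (contract G e)) + 1 = card (verts G)"
    using card_verts_identify[OF wfD ab'(2,3,1)] by (simp add: ab(2) D(2))
  have cd: "card (edges G - {e}) + 1 = card (edges G)"
    using card_Suc_Diff1[of "edges G" e] G(1) e by (simp add: wf_graph_def)
  have ec: "edges (contract G e) = edges G - {e}"
    using identify_simps(1)[OF ab'(2,3,1)] by (simp add: ab(2) D(1))
  show "card (edges (contract G e)) + 1 = card (edges G)" using ec cd by simp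
  have nG: "nblocks G = 1" using nblocks_non_separable[OF G(1,2)] e by blast
  have "flow_sum G = flow_sum (contract G e) - flow_sum (delete_edge G e)"
    using flow_rules_flow_sum G nl e unfolding flow_rules_def bridgeless_def by blast
  then have p: "poly (fsum (ends G) (edges G)) x
      = poly (fsum (ends (contract G e)) (edges (contract G e))) x
      - poly (fsum (ends (delete_edge G e)) (edges (delete_edge G e))) x"
    using G(1) wfC wfD by (simp add: flow_sum_def)
  have sc: "qsign (contract G e) = qsign G"
  proof -
    have "even (card (edges G - {e}) + card (verts (contract G e)) + nblocks (contract G e))
        \<longleftrightarrow> even (card (edges G) + card (verts G) + 1)"
      using cd cv par(2) by presburger
    then show ?thesis unfolding qsign_def nG ec by simp
  qed
  have sd: "qsign (delete_edge G e) = - qsign G"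
  proof -
    have "even (card (edges G - {e}) + card (verts G) + nblocks (delete_edge G e))
        \<longleftrightarrow> odd (card (edges G) + card (verts G) + 1)"
      using cd par(1) by presburger
    then show ?thesis unfolding qsign_def nG D by simp
  qed
  show "Qf G x = Qf (contract G e) x + Qf (delete_edge G e) x"
    unfolding Qf_qsign[OF G(1)] Qf_qsign[OF wfC] Qf_qsign[OF wfD] p sc sd by (simp add: algebra_simps)
qed

theorem theorem3p2:
  fixes S S' :: "'v graph set" and \<beta> :: real
  assumes S_graphs: "\<forall>G\<in>S. wf_graph G \<and> connected_graph G \<and> bridgeless G"
    and beta: "1 < \<beta>" "\<beta> \<le> 2"
    and sub: "S' \<subseteq> S"
    and i: "\<forall>G\<in>S'. \<forall>x. 1 < x \<and> x < \<beta> \<longrightarrow> Qf G x > 0"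
    and ii: "\<forall>G\<in>S. \<not> non_separable G \<longrightarrow> (\<forall>H. is_block G H \<longrightarrow> H \<in>\<^sub>\<cong> S)"
    and iii: "\<forall>G\<in>S - S'. non_separable G \<longrightarrow>
      (\<comment> \<open>(a)\<close>
       (\<exists>e u1 u2 v H1 H2. e \<in> edges G \<and> ends G e = Upair u1 u2 \<and>
          cut_vertex (delete_edge G e) v \<and>
          subgraph H1 (delete_edge G e) \<and> subgraph H2 (delete_edge G e) \<and>
          edges H1 \<inter> edges H2 = {} \<and> edges H1 \<union> edges H2 = edges (delete_edge G e) \<and>
          verts H1 \<inter> verts H2 = {v} \<and> verts H1 \<union> verts H2 = verts G \<and>
          u1 \<in> verts H1 \<and> u2 \<in> verts H2 \<and>
          add_edge H1 v u1 \<in>\<^sub>\<cong> S \<and> add_edge H2 v u2 \<in>\<^sub>\<cong> S)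
     \<or> \<comment> \<open>(b)\<close>
       (\<exists>e. e \<in> edges G \<and> delete_edge G e \<in>\<^sub>\<cong> S \<and> contract G e \<in>\<^sub>\<cong> S \<and>
          odd (nblocks (delete_edge G e)) \<and> odd (nblocks (contract G e)))
     \<or> \<comment> \<open>(c)\<close>
       (\<exists>G1 G2 u1 u2. subgraph G1 G \<and> subgraph G2 G \<and>
          verts G1 \<inter> verts G2 = {u1, u2} \<and> verts G1 \<union> verts G2 = verts G \<and>
          edges G1 \<inter> edges G2 = {} \<and> edges G1 \<union> edges G2 = edges G \<and>
          even (nblocks G1 + nblocks G2) \<and>
          card (edges G1) \<ge> 2 \<and> card (edges G2) \<ge> 2 \<and>
          G1 \<in>\<^sub>\<cong> S \<and> add_edge G1 u1 u2 \<in>\<^sub>\<cong> S \<and>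
          G2 \<in>\<^sub>\<cong> S \<and> add_edge G2 u1 u2 \<in>\<^sub>\<cong> S)
     \<or> \<comment> \<open>(d)\<close>
       (\<exists>G1 G2 u1 u2. subgraph G1 G \<and> subgraph G2 G \<and>
          card (edges G1) \<ge> 3 \<and> card (edges G2) \<ge> 2 \<and>
          verts G1 \<inter> verts G2 = {u1, u2} \<and> verts G1 \<union> verts G2 = verts G \<and>
          edges G1 \<inter> edges G2 = {} \<and> edges G1 \<union> edges G2 = edges G \<and>
          odd (nblocks (identify G1 u1 u2) + nblocks G2) \<and>
          add_edge G1 u1 u2 \<in>\<^sub>\<cong> S \<and> identify G1 u1 u2 \<in>\<^sub>\<cong> S \<and>
          G2 \<in>\<^sub>\<cong> S \<and> add_edge G2 u1 u2 \<in>\<^sub>\<cong> S \<and>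
          add_edge (add_edge G2 u1 u2) u1 u2 \<in>\<^sub>\<cong> S))"
  shows "\<forall>G\<in>S. \<forall>x::real. 1 < x \<and> x < \<beta> \<longrightarrow> Qf G x > 0"
proof (intro ballI allI impI)
  fix G x assume "G \<in> S" and x: "1 < x \<and> x < \<beta>"
  then show "Qf G x > 0"
  \<comment> \<open>Vertices enter the measure for steps where a drop in the number of edges is not
    established: a proper block may be smaller in vertices only, and in (a) one part gets back the
    lost edge.\<close>
  proof (induction "card (edges G) + card (verts G)" arbitrary: G rule: less_induct)
    case less
    note GS = less.prems(1)
    have wf: "wf_graph G" and con: "connected_graph G" and br: "bridgeless G"
      using S_graphs GS by auto
    have fin: "finite (edges G)" "finite (verts G)" using wf by (auto simp: wf_graph_def)
    \<comment> \<open>The induction hypothesis transferred from members of the family to their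
      isomorphic copies.\<close>
    have IH: "Qf K x > 0" if "K \<in>\<^sub>\<cong> S" "wf_graph K"
      "card (edges K) + card (verts K) < card (edges G) + card (verts G)" for K
    proof -
      obtain L where L: "L \<in> S" "graph_iso L K" using \<open>K \<in>\<^sub>\<cong> S\<close> by (auto simp: in_family_def)
      then have "wf_graph L" using S_graphs by auto
      note iso = graph_iso_invariants[OF this that(2) L(2)]
      have "Qf L x > 0" using less.hyps[of L] iso(1,2) that(3) L(1) x by simp
      then show ?thesis using iso(3) by simp
    qed
    consider (base) "G \<in> S'" | (sep) "\<not> non_separable G" | (nonsep) "G \<in> S - S'" "non_separable G"
      using GS by blast
    then show ?case
    proof cases
      case base
      then show ?thesis using i x by blast
    next
      case sep
      show ?thesis
      proof (rule Qf_pos_if_blocks_pos[OF wf con])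
        fix B assume B: "is_block G B"
        have sub: "subgraph B G" by (rule is_block_subgraph[OF B])
        then have B': "wf_graph B" "verts B \<subseteq> verts G" "edges B \<subseteq> edges G" "ends B = ends G"
          by (auto simp: subgraph_def)
        have "B \<noteq> G" using B sep by (auto simp: is_block_def)
        then have "edges B \<noteq> edges G \<or> verts B \<noteq> verts G" using graph_eqI B'(4) by blast
        then have "card (edges B) < card (edges G) \<or> card (verts B) < card (verts G)"
          using B'(2,3) fin psubset_card_mono psubsetI by meson
        then have "card (edges B) + card (verts B) < card (edges G) + card (verts G)"
          using card_mono[OF fin(1) B'(3)] card_mono[OF fin(2) B'(2)] by linarith
        moreover have "B \<in>\<^sub>\<cong> S" using ii GS sep B by blast
        ultimately show "Qf B x > 0" using IH B'(1) by blast
      qed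
    next
      case nonsep
      have x0: "x - 1 > 0" using x by simp
      from iii[rule_format, OF nonsep] show ?thesis
      proof (elim disjE exE conjE)
        fix e u1 u2 v H1 H2
        assume e: "e \<in> edges G" "ends G e = Upair u1 u2" and cut: "cut_vertex (delete_edge G e) v"
          and H: "subgraph H1 (delete_edge G e)" "subgraph H2 (delete_edge G e)"
            "edges H1 \<inter> edges H2 = {}" "edges H1 \<union> edges H2 = edges (delete_edge G e)"
            "verts H1 \<inter> verts H2 = {v}" "verts H1 \<union> verts H2 = verts G"
          and u: "u1 \<in> verts H1" "u2 \<in> verts H2"
          and S: "add_edge H1 v u1 \<in>\<^sub>\<cong> S" "add_edge H2 v u2 \<in>\<^sub>\<cong> S"
        have os: "one_sum (delete_edge G e) v H1 H2"
          using H by (simp add: one_sum_def delete_edge_def)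
        have "v \<notin> set_uprod (ends G e)"
          using cut_vertex_delete_edge_end[OF wf con br cut] nonsep(2) by (auto simp: non_separable_def)
        then have uv: "u1 \<noteq> v" "u2 \<noteq> v" using e(2) by auto
        have wfH: "wf_graph H1" "wf_graph H2" and vH: "v \<in> verts H1" "v \<in> verts H2"
          using H by (auto simp: subgraph_def)
        have finH: "finite (edges H1)" "finite (edges H2)" using wfH by (auto simp: wf_graph_def)
        have "card (edges G) = Suc (card (edges G - {e}))"
          using card_Suc_Diff1[OF fin(1) e(1)] by simp
        also have "edges G - {e} = edges H1 \<union> edges H2" using H(4) by (simp add: delete_edge_def)
        also have "card (edges H1 \<union> edges H2) = card (edges H1) + card (edges H2)"
          by (rule card_Un_disjoint[OF finH H(3)])
        finally have cE: "card (edges G) = Suc (card (edges H1) + card (edges H2))" .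
        \<comment> \<open>Since \<open>u1\<close> and \<open>u2\<close> differ from the only common
          vertex \<open>v\<close>, each part misses one of them.\<close>
        have "verts H1 \<subset> verts G" "verts H2 \<subset> verts G" using H(5,6) u uv by blast+
        then have cV: "card (verts H1) < card (verts G)" "card (verts H2) < card (verts G)"
          using fin(2) by (simp_all add: psubset_card_mono)
        have "Qf (add_edge H1 v u1) x > 0" "Qf (add_edge H2 v u2) x > 0"
          by (rule IH[OF S(1) wf_graph_add_edge[OF wfH(1) vH(1) u(1)]],
              simp add: card_edges_add_edge finH cE, use cV in linarith)
            (rule IH[OF S(2) wf_graph_add_edge[OF wfH(2) vH(2) u(2)]],
              simp add: card_edges_add_edge finH cE, use cV in linarith)
        then have "(x - 1) * Qf G x > 0"
          using Qf_one_sum_edge[OF wf nonsep(2) os e u uv] by simp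
        then show ?thesis using x0 by (simp add: zero_less_mult_iff)
      next
        fix e
        assume e: "e \<in> edges G" and S: "delete_edge G e \<in>\<^sub>\<cong> S" "contract G e \<in>\<^sub>\<cong> S"
          and par: "odd (nblocks (delete_edge G e))" "odd (nblocks (contract G e))"
        note dc = Qf_delete_contract[OF wf nonsep(2) br e par]
        have "card (edges G - {e}) < card (edges G)" by (rule card_Diff1_less[OF fin(1) e])
        then have "Qf (delete_edge G e) x > 0"
          by (intro IH[OF S(1) wf_graph_delete_edge[OF wf]]) (simp add: delete_edge_def)
        moreover have "Qf (contract G e) x > 0" by (rule IH[OF S(2) dc(4)]) (use dc(2,3) in linarith)
        ultimately show ?thesis using dc(1)[of x] by simp
      next
        fix H K u v
        assume H: "subgraph H G" "subgraph K G" "verts H \<inter> verts K = {u, v}"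
            "verts H \<union> verts K = verts G" "edges H \<inter> edges K = {}" "edges H \<union> edges K = edges G"
          and par: "even (nblocks H + nblocks K)" and c2: "2 \<le> card (edges H)" "2 \<le> card (edges K)"
          and S: "H \<in>\<^sub>\<cong> S" "add_edge H u v \<in>\<^sub>\<cong> S" "K \<in>\<^sub>\<cong> S" "add_edge K u v \<in>\<^sub>\<cong> S"
        have ts: "two_sum G u v H K" using H by (simp add: two_sum_def)
        have ne: "edges H \<noteq> {}" "edges K \<noteq> {}" using c2 by auto
        have wfH: "wf_graph H" "wf_graph K" and V: "u \<in> verts H" "v \<in> verts H" "u \<in> verts K" "v \<in> verts K"
          using H by (auto simp: subgraph_def)
        have finH: "finite (edges H)" "finite (edges K)" using wfH by (auto simp: wf_graph_def)
        note cE = two_sum_card(1)[OF wf ts two_sum_distinct[OF wf nonsep(2) ts ne]]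
        have cV: "card (verts H) \<le> card (verts G)" "card (verts K) \<le> card (verts G)"
          using H(4) fin(2) by (auto intro!: card_mono)
        have "Qf H x > 0" by (rule IH[OF S(1) wfH(1)]) (use cE cV c2 in linarith)
        moreover have "Qf K x > 0" by (rule IH[OF S(3) wfH(2)]) (use cE cV c2 in linarith)
        \<comment> \<open>The added edge is outweighed by the at least 2 edges of the other
          part.\<close>
        moreover have "Qf (add_edge H u v) x > 0"
          by (rule IH[OF S(2) wf_graph_add_edge[OF wfH(1) V(1,2)]])
            (simp add: card_edges_add_edge finH, use cE cV c2 in linarith)
        moreover have "Qf (add_edge K u v) x > 0"
          by (rule IH[OF S(4) wf_graph_add_edge[OF wfH(2) V(3,4)]])
            (simp add: card_edges_add_edge finH, use cE cV c2 in linarith)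
        ultimately have "(x - 1) * Qf G x > 0"
          using Qf_two_sum[OF wf nonsep(2) ts ne par, of x] x0 by (simp add: add_pos_pos)
        then show ?thesis using x0 by (simp add: zero_less_mult_iff)
      next
        fix H K u v
        assume H: "subgraph H G" "subgraph K G" "verts H \<inter> verts K = {u, v}"
            "verts H \<union> verts K = verts G" "edges H \<inter> edges K = {}" "edges H \<union> edges K = edges G"
          and par: "odd (nblocks (identify H u v) + nblocks K)"
          and c2: "3 \<le> card (edges H)" "2 \<le> card (edges K)"
          and S: "add_edge H u v \<in>\<^sub>\<cong> S" "identify H u v \<in>\<^sub>\<cong> S" "K \<in>\<^sub>\<cong> S"
            "add_edge K u v \<in>\<^sub>\<cong> S" "add_edge (add_edge K u v) u v \<in>\<^sub>\<cong> S"
        have ts: "two_sum G u v H K" using H by (simp add: two_sum_def)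
        have ne: "edges H \<noteq> {}" "edges K \<noteq> {}" using c2 by auto
        note uv = two_sum_distinct[OF wf nonsep(2) ts ne]
        have wfH: "wf_graph H" "wf_graph K" and V: "u \<in> verts H" "v \<in> verts H" "u \<in> verts K" "v \<in> verts K"
          using H by (auto simp: subgraph_def)
        have wfK: "wf_graph (add_edge K u v)" by (rule wf_graph_add_edge[OF wfH(2) V(3,4)])
        have finH: "finite (edges H)" "finite (edges K)" "finite (edges (add_edge K u v))"
          using wfH wfK by (auto simp: wf_graph_def)
        note cE = two_sum_card(1)[OF wf ts uv] and cI = card_verts_identify[OF wfH(1) V(1,2) uv]
        have cV: "card (verts H) \<le> card (verts G)" "card (verts K) \<le> card (verts G)"
          using H(4) fin(2) by (auto intro!: card_mono)
        have "Qf K x > 0" by (rule IH[OF S(3) wfH(2)]) (use cE cV c2 in linarith)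
        moreover have "Qf (identify H u v) x > 0"
          by (rule IH[OF S(2) wf_graph_identify[OF wfH(1)]])
            (simp only: identify_simps(1)[OF V(1,2) uv], use cE cV c2 cI in linarith)
        moreover have "Qf (add_edge H u v) x > 0"
          by (rule IH[OF S(1) wf_graph_add_edge[OF wfH(1) V(1,2)]])
            (simp add: card_edges_add_edge finH, use cE cV c2 in linarith)
        moreover have "Qf (add_edge K u v) x > 0"
          by (rule IH[OF S(4) wfK]) (simp add: card_edges_add_edge finH, use cE cV c2 in linarith)
        \<comment> \<open>Here the bound 3 on the edges of \<open>H\<close> is used: two edges are
          added to \<open>K\<close>.\<close>
        moreover have "Qf (add_edge (add_edge K u v) u v) x > 0"
          by (rule IH[OF S(5) wf_graph_add_edge[OF wfK]])
            (simp_all add: V card_edges_add_edge finH, use cE cV c2 in linarith)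
        ultimately have "(x - 1) * Qf G x > 0"
          using Qf_two_sum_identify[OF wf nonsep(2) ts ne par, of x] x0 by (simp add: add_pos_pos)
        then show ?thesis using x0 by (simp add: zero_less_mult_iff)
      qed
    qed
  qed
qed

end
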